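(* Let $\Phi$ be a strict (resp. genuine projective) dihedral configuration of $2n$ unit vectors in $\mathbb{C}^n$. Then $\Phi$ is a regular $\mathrm{ETF}(2n,n)$ if and only if there exists a skew Hadamard matrix $H=[P,Q;-Q^\top,P^\top]$ with $P,Q$ circulant (resp. negacirculant) $n\times n$ matrices for which, up to switching equivalence, $$\Phi^*\Phi=I_{2n}+\frac{1}{\sqrt{2n-1}}\begin{bmatrix}\mathrm{i}(P-I_n) & Q\\ Q^\top & \mathrm{i}(P^\top-I_n)\end{bmatrix}.$$
   Context: $D_n$ is generated by $\mu,\tau$ with $\mu^n=\tau^2=1$, $\tau\mu=\mu^{-1}\tau$, elements ordered $1,\mu,\dots,\mu^{n-1},\tau,\mu\tau,\dots,\mu^{n-1}\tau$. A projective unitary representation $\pi:D_n\to U(n)$ satisfies $\pi(gg')=c\,\pi(g)\pi(g')$ with $|c|=1$; it is strict if it is a homomorphism; $\pi,\pi'$ are equivalent if for a fixed unitary $Q$, $Q\pi(g)Q^*$ equals $\pi'(g)$ up to unimodular scalars. A dihedral configuration is the ordered family $(\pi(g)v)_{g\in D_n}$ with $v$ a unit vector; it is strict if $\pi$ is equivalent to a strict representation, genuine projective otherwise; it is regular if $v,\pi(\mu)v,\dots,\pi(\mu^{n-1})v$ is a basis of $\mathbb{C}^n$. An $\mathrm{ETF}(2n,n)$: $2n$ unit vectors in $\mathbb{C}^n$ forming a tight frame with constant $|\langle\varphi_i,\varphi_j\rangle|$, $i\ne j$. "Up to switching equivalence" means $\Pi\Phi^*\Phi\Pi^*$ equals the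 displayed matrix for some phase monomial matrix $\Pi$ (diagonal unimodular times permutation). Skew Hadamard: $H\in\{\pm1\}^{m\times m}$, $HH^\top=mI$, $H+H^\top=2I$. Circulant: $(i,j)$ entry depends only on $(j-i)\bmod n$; negacirculant: entries $w_{j-i}$ for $j\ge i$ and $-w_{n+j-i}$ for $j<i$ for some vector $w$. *)

theory Defs
  imports Complex_Main "HOL-Algebra.Group" "HOL-Combinatorics.Permutations"
    "Jordan_Normal_Form.Matrix" "Jordan_Normal_Form.Schur_Decomposition"
    "Jordan_Normal_Form.VS_Connect"
begin

section \<open>The dihedral group\<close>

text \<open>The pair \<open>(k, e)\<close> with \<open>k < n\<close> stands for \<open>\<mu>\<^sup>k \<tau>\<^sup>e\<close>, where \<open>e\<close> is read as 0 or 1.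
  The group has \<open>2 n\<close> elements for every \<open>n \<ge> 1\<close>, including \<open>n = 1\<close> and \<open>n = 2\<close>;
  the product encodes \<open>\<tau> \<mu>\<^sup>l = \<mu>\<^sup>-\<^sup>l \<tau>\<close>.\<close>

definition dihedral :: "nat \<Rightarrow> (nat \<times> bool) monoid" where
  "dihedral n = \<lparr>carrier = {..<n} \<times> UNIV,
     monoid.mult = (\<lambda>(k, e) (l, f). (nat ((if e then int k - int l else int k + int l) mod int n), e \<noteq> f)),
     one = (0, False)\<rparr>"

definition dih_mu :: "nat \<Rightarrow> nat \<times> bool" where
  "dih_mu n = (1 mod n, False)"

definition dih_tau :: "nat \<times> bool" where
  "dih_tau = (0, True)"

text \<open>The enumeration \<open>1, \<mu>, \<dots>, \<mu>\<^sup>n\<^sup>-\<^sup>1, \<tau>, \<mu>\<tau>, \<dots>, \<mu>\<^sup>n\<^sup>-\<^sup>1\<tau>\<close>, indexed by \<open>{..<2 * n}\<close>.\<close>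

definition dih_elem :: "nat \<Rightarrow> nat \<Rightarrow> nat \<times> bool" where
  "dih_elem n j =
     (if j < n then dih_mu n [^]\<^bsub>dihedral n\<^esub> j
      else dih_mu n [^]\<^bsub>dihedral n\<^esub> (j - n) \<otimes>\<^bsub>dihedral n\<^esub> dih_tau)"

lemma dihedral_group:
  assumes "n \<ge> 1"
  shows "group (dihedral n)"
proof (rule groupI)
  fix x y z
  assume "x \<in> carrier (dihedral n)" "y \<in> carrier (dihedral n)" "z \<in> carrier (dihedral n)"
  then obtain a e b f c g where xyz: "x = (a, e)" "y = (b, f)" "z = (c, g)"
    and lt: "a < n" "b < n" "c < n"
    by (auto simp: dihedral_def)
  show "x \<otimes>\<^bsub>dihedral n\<^esub> y \<otimes>\<^bsub>dihedral n\<^esub> z = x \<otimes>\<^bsub>dihedral n\<^esub> (y \<otimes>\<^bsub>dihedral n\<^esub> z)"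
    unfolding xyz using assms
    by (cases e; cases f; cases g; simp add: dihedral_def mod_simps algebra_simps)
next
  fix x assume "x \<in> carrier (dihedral n)"
  then obtain a e where x: "x = (a, e)" "a < n" by (auto simp: dihedral_def)
  show "\<exists>y\<in>carrier (dihedral n). y \<otimes>\<^bsub>dihedral n\<^esub> x = \<one>\<^bsub>dihedral n\<^esub>"
    using x assms
    by (intro bexI[of _ "if e then (a, True) else (nat ((- int a) mod int n), False)"])
      (auto simp: dihedral_def mod_simps nat_less_iff)
qed (use assms in \<open>auto simp: dihedral_def nat_less_iff\<close>)

lemma dih_mu_pow:
  assumes "n \<ge> 1"
  shows "dih_mu n [^]\<^bsub>dihedral n\<^esub> (k::nat) = (k mod n, False)"
proof -
  interpret group "dihedral n" using dihedral_group[OF assms] .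
  have step: "(k mod n, False) \<otimes>\<^bsub>dihedral n\<^esub> dih_mu n = (Suc k mod n, False)" for k
    using assms
    by (simp add: dihedral_def dih_mu_def nat_mod_as_int zmod_int mod_simps add.commute)
  show ?thesis
  proof (induction k)
    case 0
    then show ?case by simp (simp add: dihedral_def)
  next
    case (Suc k)
    then show ?case by (simp add: step)
  qed
qed

lemma dih_elem_eq:
  assumes "j < 2 * n"
  shows "dih_elem n j = (if j < n then (j, False) else (j - n, True))"
proof -
  have n: "n \<ge> 1" using assms by simp
  have pow: "dih_mu n [^]\<^bsub>dihedral n\<^esub> k = (k, False)" if "k < n" for k
    using dih_mu_pow[OF n, of k] that by simp
  have tau: "(k, False) \<otimes>\<^bsub>dihedral n\<^esub> dih_tau = (k, True)" if "k < n" for k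
    using that by (simp add: dihedral_def dih_tau_def)
  show ?thesis
    using assms pow tau by (simp add: dih_elem_def)
qed

lemma dihedral_presentation:
  assumes "n \<ge> 1"
  shows "dih_mu n \<in> carrier (dihedral n)" "dih_tau \<in> carrier (dihedral n)"
    and "dih_mu n [^]\<^bsub>dihedral n\<^esub> n = \<one>\<^bsub>dihedral n\<^esub>"
    and "dih_tau \<otimes>\<^bsub>dihedral n\<^esub> dih_tau = \<one>\<^bsub>dihedral n\<^esub>"
    and "dih_tau \<otimes>\<^bsub>dihedral n\<^esub> dih_mu n = inv\<^bsub>dihedral n\<^esub> dih_mu n \<otimes>\<^bsub>dihedral n\<^esub> dih_tau"
    and "card (carrier (dihedral n)) = 2 * n"
    and "bij_betw (dih_elem n) {..<2 * n} (carrier (dihedral n))"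
proof -
  interpret group "dihedral n" using dihedral_group[OF assms] .
  show mu: "dih_mu n \<in> carrier (dihedral n)" and tau: "dih_tau \<in> carrier (dihedral n)"
    using assms by (auto simp: dihedral_def dih_mu_def dih_tau_def)
  show "dih_mu n [^]\<^bsub>dihedral n\<^esub> n = \<one>\<^bsub>dihedral n\<^esub>"
    using dih_mu_pow[OF assms, of n] by (simp add: dihedral_def)
  show "dih_tau \<otimes>\<^bsub>dihedral n\<^esub> dih_tau = \<one>\<^bsub>dihedral n\<^esub>"
    using assms by (simp add: dihedral_def dih_tau_def)
  have inv: "inv\<^bsub>dihedral n\<^esub> dih_mu n = (nat ((- 1) mod int n), False)"
    using assms
    by (intro inv_equality mu) (auto simp: dihedral_def dih_mu_def nat_less_iff zmod_int mod_simps)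
  show "dih_tau \<otimes>\<^bsub>dihedral n\<^esub> dih_mu n = inv\<^bsub>dihedral n\<^esub> dih_mu n \<otimes>\<^bsub>dihedral n\<^esub> dih_tau"
    unfolding inv using assms by (simp add: dihedral_def dih_mu_def dih_tau_def zmod_int mod_simps)
  show "card (carrier (dihedral n)) = 2 * n"
    by (simp add: dihedral_def card_cartesian_product)
  show "bij_betw (dih_elem n) {..<2 * n} (carrier (dihedral n))"
    by (rule bij_betwI[where g = "\<lambda>(k, e). if e then n + k else k"])
      (auto simp: dih_elem_eq dihedral_def split: if_splits)
qed

section \<open>Projective unitary representations\<close>

definition unitary_group :: "nat \<Rightarrow> complex mat monoid" where
  "unitary_group n = \<lparr>carrier = {U \<in> carrier_mat n n.
       mat_adjoint U * U = 1\<^sub>m n \<and> U * mat_adjoint U = 1\<^sub>m n},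
     monoid.mult = (*), one = 1\<^sub>m n\<rparr>"

definition proj_unitary_rep :: "nat \<Rightarrow> (nat \<times> bool \<Rightarrow> complex mat) \<Rightarrow> bool" where
  "proj_unitary_rep n \<pi> \<longleftrightarrow>
     \<pi> \<in> carrier (dihedral n) \<rightarrow> carrier (unitary_group n) \<and>
     (\<forall>g\<in>carrier (dihedral n). \<forall>g'\<in>carrier (dihedral n).
        \<exists>c. cmod c = 1 \<and> \<pi> (g \<otimes>\<^bsub>dihedral n\<^esub> g') = c \<cdot>\<^sub>m (\<pi> g * \<pi> g'))"

definition strict_rep :: "nat \<Rightarrow> (nat \<times> bool \<Rightarrow> complex mat) \<Rightarrow> bool" where
  "strict_rep n \<pi> \<longleftrightarrow> \<pi> \<in> hom (dihedral n) (unitary_group n)"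

definition equivalent_reps ::
  "nat \<Rightarrow> (nat \<times> bool \<Rightarrow> complex mat) \<Rightarrow> (nat \<times> bool \<Rightarrow> complex mat) \<Rightarrow> bool" where
  "equivalent_reps n \<pi> \<pi>' \<longleftrightarrow>
     (\<exists>Q\<in>carrier (unitary_group n). \<forall>g\<in>carrier (dihedral n).
        \<exists>c. cmod c = 1 \<and> Q * \<pi> g * mat_adjoint Q = c \<cdot>\<^sub>m \<pi>' g)"

section \<open>Dihedral configurations\<close>

definition dihedral_configuration ::
  "nat \<Rightarrow> (nat \<times> bool \<Rightarrow> complex mat) \<Rightarrow> complex vec \<Rightarrow> bool" where
  "dihedral_configuration n \<pi> v \<longleftrightarrow>
     proj_unitary_rep n \<pi> \<and> v \<in> carrier_vec n \<and> v \<bullet>c v = 1"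

definition strict_configuration ::
  "nat \<Rightarrow> (nat \<times> bool \<Rightarrow> complex mat) \<Rightarrow> complex vec \<Rightarrow> bool" where
  "strict_configuration n \<pi> v \<longleftrightarrow>
     dihedral_configuration n \<pi> v \<and> (\<exists>\<pi>'. strict_rep n \<pi>' \<and> equivalent_reps n \<pi> \<pi>')"

definition genuine_projective_configuration ::
  "nat \<Rightarrow> (nat \<times> bool \<Rightarrow> complex mat) \<Rightarrow> complex vec \<Rightarrow> bool" where
  "genuine_projective_configuration n \<pi> v \<longleftrightarrow>
     dihedral_configuration n \<pi> v \<and> \<not> strict_configuration n \<pi> v"

text \<open>The ordered family \<open>(\<pi>(g) v)\<close>, stored as the columns of the \<open>n \<times> 2 n\<close> synthesis matrix.\<close>

definition config_mat :: "nat \<Rightarrow> (nat \<times> bool \<Rightarrow> complex mat) \<Rightarrow> complex vec \<Rightarrow> complex mat" where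
  "config_mat n \<pi> v = mat_of_cols n (map (\<lambda>j. \<pi> (dih_elem n j) *\<^sub>v v) [0..<2 * n])"

text \<open>\<open>distinct\<close> makes the condition one on the family rather than on its set of members.\<close>

definition regular_configuration ::
  "nat \<Rightarrow> (nat \<times> bool \<Rightarrow> complex mat) \<Rightarrow> complex vec \<Rightarrow> bool" where
  "regular_configuration n \<pi> v \<longleftrightarrow>
     (let ws = v # map (\<lambda>k. \<pi> (dih_mu n [^]\<^bsub>dihedral n\<^esub> k) *\<^sub>v v) [1..<n]
      in distinct ws \<and> vectorspace.basis class_ring (module_vec TYPE(complex) n) (set ws))"

section \<open>Equiangular tight frames\<close>

text \<open>The frame consists of the \<open>m\<close> columns of \<open>\<Phi>\<close>, vectors in dimension \<open>d\<close>.\<close>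

definition tight_frame :: "nat \<Rightarrow> nat \<Rightarrow> complex mat \<Rightarrow> bool" where
  "tight_frame m d \<Phi> \<longleftrightarrow> \<Phi> \<in> carrier_mat d m \<and>
     (\<exists>A::real. A > 0 \<and> (\<forall>x\<in>carrier_vec d.
        (\<Sum>j<m. (cmod (x \<bullet>c col \<Phi> j))\<^sup>2) = A * Re (x \<bullet>c x)))"

definition is_ETF :: "nat \<Rightarrow> nat \<Rightarrow> complex mat \<Rightarrow> bool" where
  "is_ETF m d \<Phi> \<longleftrightarrow> tight_frame m d \<Phi> \<and>
     (\<forall>j<m. col \<Phi> j \<bullet>c col \<Phi> j = 1) \<and>
     (\<exists>\<alpha>::real. \<forall>i<m. \<forall>j<m. i \<noteq> j \<longrightarrow> cmod (col \<Phi> i \<bullet>c col \<Phi> j) = \<alpha>)"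

section \<open>Structured matrices\<close>

definition phase_monomial :: "nat \<Rightarrow> complex mat \<Rightarrow> bool" where
  "phase_monomial m M \<longleftrightarrow>
     (\<exists>d \<sigma>. (\<forall>i<m. cmod (d i) = 1) \<and> \<sigma> permutes {..<m} \<and>
        M = mat_diag m d * mat m m (\<lambda>(i, j). if j = \<sigma> i then 1 else 0))"

definition switching_equivalent :: "nat \<Rightarrow> complex mat \<Rightarrow> complex mat \<Rightarrow> bool" where
  "switching_equivalent m G G' \<longleftrightarrow>
     (\<exists>M. phase_monomial m M \<and> M * G * mat_adjoint M = G')"

definition skew_hadamard :: "nat \<Rightarrow> real mat \<Rightarrow> bool" where
  "skew_hadamard m H \<longleftrightarrow> H \<in> carrier_mat m m \<and>
     (\<forall>i<m. \<forall>j<m. H $$ (i, j) \<in> {1, -1}) \<and>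
     H * transpose_mat H = real m \<cdot>\<^sub>m 1\<^sub>m m \<and>
     H + transpose_mat H = 2 \<cdot>\<^sub>m 1\<^sub>m m"

definition circulant :: "nat \<Rightarrow> real mat \<Rightarrow> bool" where
  "circulant n A \<longleftrightarrow> A \<in> carrier_mat n n \<and>
     (\<exists>w::nat \<Rightarrow> real. \<forall>i<n. \<forall>j<n. A $$ (i, j) = w (nat ((int j - int i) mod int n)))"

definition negacirculant :: "nat \<Rightarrow> real mat \<Rightarrow> bool" where
  "negacirculant n A \<longleftrightarrow> A \<in> carrier_mat n n \<and>
     (\<exists>w::nat \<Rightarrow> real. \<forall>i<n. \<forall>j<n.
        A $$ (i, j) = (if i \<le> j then w (j - i) else - w (n + j - i)))"

definition skew_block :: "real mat \<Rightarrow> real mat \<Rightarrow> real mat" where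
  "skew_block P Q = four_block_mat P Q (- transpose_mat Q) (transpose_mat P)"

definition target_gram :: "nat \<Rightarrow> real mat \<Rightarrow> real mat \<Rightarrow> complex mat" where
  "target_gram n P Q = 1\<^sub>m (2 * n) +
     complex_of_real (1 / sqrt (2 * real n - 1)) \<cdot>\<^sub>m
       four_block_mat
         (\<i> \<cdot>\<^sub>m map_mat complex_of_real (P - 1\<^sub>m n)) (map_mat complex_of_real Q)
         (map_mat complex_of_real (transpose_mat Q))
         (\<i> \<cdot>\<^sub>m map_mat complex_of_real (transpose_mat P - 1\<^sub>m n))"

end

theory Submission
  imports Defs "HOL-Number_Theory.Residues" "HOL-Computational_Algebra.Nth_Powers"
    "Jordan_Normal_Form.DL_Rank"
begin

text \<open>After rescaling by phases a projective representation is given by unitaries \<open>U, W\<close> with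
  \<open>W\<^sup>2 = 1\<close>, \<open>U W U = W\<close> and \<open>U\<^sup>n = z\<close>, where \<open>z = 1\<close> in the strict and \<open>z = -1\<close> in the genuine
  projective case. The Gram matrix is then built from \<open>a j = \<langle>U\<^sup>j v, v\<rangle>\<close> and
  \<open>b j = \<langle>U\<^sup>j W v, v\<rangle>\<close>. Each \<open>U\<^sup>j W\<close> is an involution, so \<open>b\<close> is real; for a tight frame the
  convolution of \<open>b\<close> with \<open>a j + a (-j) - 2 \<delta>\<^sub>j\<close> vanishes, which in the regular case forces the
  off-diagonal \<open>a j\<close> to be purely imaginary.

  Conversely, switching may permute the vectors, so regularity is not immediate from the shape of
  the matrix. If it failed, some Fourier coefficient of \<open>a\<close> would vanish, which would produce an
  element of \<open>\<int>[\<zeta>]\<close>, \<open>\<zeta>\<^sup>2\<^sup>n = 1\<close>, with square \<open>-(2 n - 1)\<close>. For \<open>n > 1\<close> the order \<open>2 n\<close> of a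
  Hadamard matrix is divisible by 4, so \<open>2 n - 1 \<equiv> 3\<close> modulo 4 has a prime factor of odd
  multiplicity; being coprime to \<open>2 n\<close>, it is unramified in \<open>\<int>[\<zeta>]\<close>: a contradiction.\<close>

section \<open>Square roots in cyclotomic integer rings\<close>

text \<open>The obstacle in the converse is that switching hides both the order and the phases of
  the vectors. What survives is \<open>a (l - k) = \<plusminus> \<i> r e k cnj (e l)\<close> with
  \<open>r = 1 / sqrt (2 n - 1)\<close> and unknown unimodular \<open>e\<close>. The left side
  depends on \<open>l - k\<close> only; comparing neighbouring pairs shows that
  \<open>e 0 cnj (e j)\<close> is \<open>\<omega> ^ j\<close> up to sign for one fixed
  \<open>\<omega>\<close>, and \<open>a (n - 1) = z cnj (a 1)\<close> forces
  \<open>\<omega> ^ (2 n) = 1\<close>. A vanishing Fourier coefficient then reads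
  \<open>1 + \<i> r \<beta> = 0\<close> with \<open>\<beta>\<close> a signed sum of powers of a root
  of unity, whence \<open>\<beta>\<^sup>2 = - 1 / r\<^sup>2 = - (2 n - 1)\<close>. Regularity has to
  be settled before tightness: the relation \<open>G\<^sup>2 = 2 G\<close> for the Gram matrix
  \<open>G\<close> controls the frame operator only on the span of the vectors. Hadamard and Gram
  matrices are linked by the diagonal matrix with entries 1 on the first half and \<i> on the
  second: conjugating \<open>\<i> r (H - 1)\<close> by it and adding 1 gives the target. As
  \<open>H - 1\<close> is skew, the target satisfies \<open>G\<^sup>2 = 2 G\<close> exactly when the
  rows of \<open>H\<close> are orthogonal.\<close>

inductive_set int_span_powers :: "complex \<Rightarrow> complex set" for \<zeta> where
  monom: "of_int c * \<zeta> ^ k \<in> int_span_powers \<zeta>"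
| add: "x \<in> int_span_powers \<zeta> \<Longrightarrow> y \<in> int_span_powers \<zeta> \<Longrightarrow> x + y \<in> int_span_powers \<zeta>"

lemma int_span_powers_of_int: "of_int c \<in> int_span_powers \<zeta>"
  using int_span_powers.monom[of c \<zeta> 0] by simp

text \<open>Monomials multiply to monomials, so the additive span is the ring
  \<open>\<int>[\<zeta>]\<close>. Generating it only additively leaves later inductions with two
  cases, monomials and sums.\<close>

lemma int_span_powers_mult:
  assumes "x \<in> int_span_powers \<zeta>" "y \<in> int_span_powers \<zeta>"
  shows "x * y \<in> int_span_powers \<zeta>"
  using assms(1)
proof induction
  case (monom c k)
  show ?case using assms(2)
  proof induction
    case (monom d l)
    have "of_int c * \<zeta> ^ k * (of_int d * \<zeta> ^ l) = of_int (c * d) * \<zeta> ^ (k + l)"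
      by (simp add: power_add)
    then show ?case by (metis int_span_powers.monom)
  qed (simp add: distrib_left int_span_powers.add)
qed (simp add: distrib_right int_span_powers.add)

lemma int_span_powers_minus: "x \<in> int_span_powers \<zeta> \<Longrightarrow> - x \<in> int_span_powers \<zeta>"
  using int_span_powers_mult[OF int_span_powers_of_int[of "-1"]] by simp

lemma int_span_powers_diff:
  "x \<in> int_span_powers \<zeta> \<Longrightarrow> y \<in> int_span_powers \<zeta> \<Longrightarrow> x - y \<in> int_span_powers \<zeta>"
  using int_span_powers.add[OF _ int_span_powers_minus] by fastforce

lemma int_span_powers_power: "x \<in> int_span_powers \<zeta> \<Longrightarrow> x ^ k \<in> int_span_powers \<zeta>"
  using int_span_powers_of_int[of 1] by (induction k) (auto intro: int_span_powers_mult)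

lemma int_span_powers_sum:
  "(\<And>i. i \<in> A \<Longrightarrow> f i \<in> int_span_powers \<zeta>) \<Longrightarrow> sum f A \<in> int_span_powers \<zeta>"
  using int_span_powers_of_int[of 0]
  by (induction A rule: infinite_finite_induct) (auto intro: int_span_powers.add)

text \<open>Exponents fold modulo \<open>N\<close>, so \<open>\<int>[\<zeta>]\<close> is finitely
  generated as an additive group; this is what makes its elements algebraic integers.\<close>

lemma int_span_powers_reduce:
  assumes "x \<in> int_span_powers \<zeta>" "\<zeta> ^ N = 1" "N > 0"
  shows "\<exists>c. x = (\<Sum>j<N. of_int (c j) * \<zeta> ^ j)"
  using assms(1)
proof induction
  case (monom c k)
  have "\<zeta> ^ k = \<zeta> ^ (N * (k div N) + k mod N)" by simp
  also have "\<dots> = \<zeta> ^ (k mod N)" by (simp only: power_add power_mult assms(2)) simp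
  finally have *: "\<zeta> ^ k = \<zeta> ^ (k mod N)" .
  have "of_int c * \<zeta> ^ k = (\<Sum>j<N. if j = k mod N then of_int c * \<zeta> ^ j else 0)"
    using assms(3) by (simp add: *)
  also have "\<dots> = (\<Sum>j<N. of_int (if j = k mod N then c else 0) * \<zeta> ^ j)"
    by (intro sum.cong) auto
  finally show ?case by (intro exI[of _ "\<lambda>j. if j = k mod N then c else 0"])
next
  case (add x y)
  then obtain c d where "x = (\<Sum>j<N. of_int (c j) * \<zeta> ^ j)" "y = (\<Sum>j<N. of_int (d j) * \<zeta> ^ j)"
    by blast
  then have "x + y = (\<Sum>j<N. of_int (c j + d j) * \<zeta> ^ j)"
    by (simp add: sum.distrib distrib_right)
  then show ?case by (intro exI[of _ "\<lambda>j. c j + d j"])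
qed

text \<open>Multiplication by \<open>x\<close> acts on
  \<open>1, \<zeta>, ..., \<zeta> ^ (N - 1)\<close> through an integer matrix. The vector of these
  powers is an eigenvector with eigenvalue \<open>x\<close>, so \<open>x\<close> is a root of the
  characteristic polynomial, which is monic with integer coefficients.\<close>

lemma int_span_powers_algebraic_int:
  assumes "x \<in> int_span_powers \<zeta>" "\<zeta> ^ N = 1" "N > 0"
  shows "algebraic_int x"
proof -
  have "\<exists>c. x * \<zeta> ^ i = (\<Sum>j<N. of_int (c j) * \<zeta> ^ j)" for i
    using int_span_powers_mult[OF assms(1) int_span_powers.monom[of 1 \<zeta> i]] assms
    by (intro int_span_powers_reduce) auto
  then obtain c where c: "\<And>i. x * \<zeta> ^ i = (\<Sum>j<N. of_int (c i j) * \<zeta> ^ j)" by metis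
  define A where "A = mat N N (\<lambda>(i, j). c i j)"
  define y where "y = vec N (\<lambda>i. \<zeta> ^ i)"
  have A: "A \<in> carrier_mat N N" by (simp add: A_def)
  let ?A = "map_mat complex_of_int A"
  have cA: "?A \<in> carrier_mat N N" using A by simp
  have "?A *\<^sub>v y = x \<cdot>\<^sub>v y"
    by (intro eq_vecI)
      (auto simp: A_def y_def c scalar_prod_def lessThan_atLeast0)
  moreover have "y \<noteq> 0\<^sub>v N"
  proof
    assume "y = 0\<^sub>v N"
    then have "y $ 0 = 0" using assms(3) by simp
    then show False using assms(3) by (simp add: y_def)
  qed
  ultimately have "eigenvalue ?A x"
    unfolding eigenvalue_def eigenvector_def by (intro exI[of _ y]) (auto simp: A_def y_def)
  then have "poly (char_poly ?A) x = 0" using eigenvalue_root_char_poly[OF cA] by simp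
  then have "poly (map_poly of_int (char_poly A)) x = 0"
    by (simp add: of_int_hom.char_poly_hom[OF A])
  moreover have "lead_coeff (char_poly A) = 1" using degree_monic_char_poly[OF A] by simp
  ultimately show ?thesis unfolding algebraic_int_altdef_ipoly by blast
qed

text \<open>The inner binomial coefficients for the exponent \<open>p\<close> are multiples of
  \<open>p\<close>. Iteration keeps the error of this form, since expanding
  \<open>(x ^ q + y ^ q + p z) ^ p\<close> adds only further multiples of \<open>p\<close>.\<close>

lemma freshman_dream:
  assumes "prime p" "x \<in> int_span_powers \<zeta>" "y \<in> int_span_powers \<zeta>"
  shows "\<exists>z\<in>int_span_powers \<zeta>. (x + y) ^ (p ^ k) = x ^ (p ^ k) + y ^ (p ^ k) + of_nat p * z"
proof -
  have step: "\<exists>z\<in>int_span_powers \<zeta>. (x + y) ^ p = x ^ p + y ^ p + of_nat p * z"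
    if x: "x \<in> int_span_powers \<zeta>" and y: "y \<in> int_span_powers \<zeta>" for x y
  proof -
    have p: "p \<ge> 2" using assms(1) by (rule prime_ge_2_nat)
    define z where "z = (\<Sum>k\<in>{1..<p}. of_int (int ((p choose k) div p)) * (x ^ k * y ^ (p - k)))"
    have "(x + y) ^ p = (\<Sum>k\<le>p. of_nat (p choose k) * x ^ k * y ^ (p - k))"
      by (rule binomial_ring)
    also have "{..p} = insert 0 (insert p {1..<p})" using p by auto
    also have "(\<Sum>k\<in>insert 0 (insert p {1..<p}). of_nat (p choose k) * x ^ k * y ^ (p - k))
        = y ^ p + (x ^ p + (\<Sum>k\<in>{1..<p}. of_nat (p choose k) * x ^ k * y ^ (p - k)))"
      using p by simp
    also have "(\<Sum>k\<in>{1..<p}. of_nat (p choose k) * x ^ k * y ^ (p - k)) = of_nat p * z"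
      unfolding z_def sum_distrib_left
    proof (rule sum.cong[OF refl])
      fix k assume "k \<in> {1..<p}"
      then have "p dvd (p choose k)" using assms(1) by (intro dvd_choose_prime) auto
      then have "(p choose k) = p * ((p choose k) div p)" by simp
      then have "complex_of_nat (p choose k) = of_nat p * of_nat ((p choose k) div p)"
        by (metis of_nat_mult)
      then show "of_nat (p choose k) * x ^ k * y ^ (p - k)
          = of_nat p * (of_int (int ((p choose k) div p)) * (x ^ k * y ^ (p - k)))"
        by simp
    qed
    finally have "(x + y) ^ p = x ^ p + y ^ p + of_nat p * z" by simp
    moreover have "z \<in> int_span_powers \<zeta>"
      unfolding z_def using x y
      by (intro int_span_powers_sum int_span_powers_mult int_span_powers_of_int int_span_powers_power)
    ultimately show ?thesis by blast
  qed
  show ?thesis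
  proof (induction k)
    case 0
    show ?case using int_span_powers_of_int[of 0] by (intro bexI[of _ 0]) auto
  next
    case (Suc k)
    let ?q = "p ^ k"
    obtain z where z: "z \<in> int_span_powers \<zeta>" "(x + y) ^ ?q = x ^ ?q + y ^ ?q + of_nat p * z"
      using Suc by blast
    have pz: "of_nat p * z \<in> int_span_powers \<zeta>"
      using int_span_powers_mult[OF int_span_powers_of_int[of "int p"] z(1)] by simp
    obtain z1 where z1: "z1 \<in> int_span_powers \<zeta>"
      "((x ^ ?q + y ^ ?q) + of_nat p * z) ^ p = (x ^ ?q + y ^ ?q) ^ p + (of_nat p * z) ^ p + of_nat p * z1"
      using step[OF int_span_powers.add[OF assms(2,3)[THEN int_span_powers_power]] pz] by blast
    obtain z2 where z2: "z2 \<in> int_span_powers \<zeta>"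
      "(x ^ ?q + y ^ ?q) ^ p = (x ^ ?q) ^ p + (y ^ ?q) ^ p + of_nat p * z2"
      using step[OF assms(2,3)[THEN int_span_powers_power]] by blast
    \<comment> \<open>Splitting off one factor exhibits \<open>(p z) ^ p\<close> as \<open>p\<close>
      times an element of the ring.\<close>
    have "p = Suc (p - 1)" using prime_gt_0_nat[OF assms(1)] by simp
    then have "(of_nat p * z) ^ p = of_nat p * (z * (of_nat p * z) ^ (p - 1))"
      by (metis mult.assoc power_Suc)
    then have "(x + y) ^ (p ^ Suc k)
        = x ^ (p ^ Suc k) + y ^ (p ^ Suc k) + of_nat p * (z * (of_nat p * z) ^ (p - 1) + z1 + z2)"
      by (simp add: power_mult mult.commute[of p] z(2) z1(2) z2(2) distrib_left)
    moreover have "z * (of_nat p * z) ^ (p - 1) + z1 + z2 \<in> int_span_powers \<zeta>"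
      by (rule int_span_powers.add[OF int_span_powers.add[OF int_span_powers_mult[OF z(1)
            int_span_powers_power[OF pz]] z1(1)] z2(1)])
    ultimately show ?case by blast
  qed
qed

lemma int_power_prime_power_cong:
  assumes "prime p"
  shows "[c ^ (p ^ k) = c] (mod int p)"
proof (induction k)
  case (Suc k)
  have fermat: "[d ^ p = d] (mod int p)" for d :: int
  proof (cases "int p dvd d")
    case True
    then show ?thesis
      using prime_gt_0_nat[OF assms] by (simp add: cong_def mod_eq_0_iff_dvd dvd_power_same dvd_trans dvd_power)
  next
    case False
    \<comment> \<open>\<open>fermat_theorem\<close> speaks of natural numbers, hence the passage to
      the least nonnegative residue.\<close>
    define r where "r = nat (d mod int p)"
    have r: "int r = d mod int p" using prime_gt_0_nat[OF assms] by (simp add: r_def)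
    then have "\<not> int p dvd int r" using False by (simp add: dvd_eq_mod_eq_0)
    then have "\<not> p dvd r" by simp
    then have "[r ^ (p - 1) = 1] (mod p)" using assms by (intro fermat_theorem) auto
    then have "[int (r ^ (p - 1)) = int 1] (mod int p)" by (simp only: cong_int_iff)
    then have "[(d mod int p) ^ (p - 1) = 1] (mod int p)" by (simp add: r)
    then have "[d ^ (p - 1) = 1] (mod int p)" by (simp add: cong_def power_mod)
    then have "[d * d ^ (p - 1) = d * 1] (mod int p)" by (rule cong_scalar_left)
    then show ?thesis
      using prime_gt_0_nat[OF assms] by (simp flip: power_Suc)
  qed
  have "[(c ^ (p ^ k)) ^ p = c ^ (p ^ k)] (mod int p)" by (rule fermat)
  also have "[c ^ (p ^ k) = c] (mod int p)" by (rule Suc)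
  finally show ?case by (simp add: power_mult[symmetric] mult.commute)
qed simp

text \<open>A power of \<open>p\<close> congruent to 1 modulo \<open>N\<close> fixes
  \<open>\<zeta>\<close>, and by Fermat it fixes integers modulo \<open>p\<close>. This iterate of
  Frobenius is thus the identity modulo \<open>p\<close> on monomials, and
  \<open>freshman_dream\<close> extends that to sums. It is the form in which \<open>p\<close> being
  unramified is used.\<close>

lemma int_span_powers_frobenius:
  assumes "prime p" "\<zeta> ^ N = 1" "[p ^ k = 1] (mod N)" "x \<in> int_span_powers \<zeta>"
  shows "\<exists>z\<in>int_span_powers \<zeta>. x ^ (p ^ k) = x + of_nat p * z"
  using assms(4)
proof induction
  case (monom c l)
  obtain d where "c ^ (p ^ k) - c = int p * d"
    using int_power_prime_power_cong[OF assms(1), of c k] unfolding cong_iff_dvd_diff by blast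
  then have d: "of_int c ^ (p ^ k) = (of_int c + of_nat p * of_int d :: complex)"
    by (metis add.commute diff_eq_eq of_int_add of_int_mult of_int_of_nat_eq of_int_power)
  have "p ^ k \<ge> 1" using prime_gt_0_nat[OF assms(1)] by simp
  then obtain q where q: "p ^ k = 1 + N * q"
    using assms(3) by (metis cong_le_nat cong_sym mult.commute add.commute)
  have "\<zeta> ^ (p ^ k) = \<zeta>" by (simp only: q power_add power_mult assms(2)) simp
  then have "(\<zeta> ^ l) ^ (p ^ k) = \<zeta> ^ l" by (metis mult.commute power_mult)
  then have "(of_int c * \<zeta> ^ l) ^ (p ^ k) = of_int c * \<zeta> ^ l + of_nat p * (of_int d * \<zeta> ^ l)"
    by (simp add: power_mult_distrib d algebra_simps)
  then show ?case using int_span_powers.monom by blast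
next
  case (add x y)
  obtain z where z: "z \<in> int_span_powers \<zeta>" "(x + y) ^ (p ^ k) = x ^ (p ^ k) + y ^ (p ^ k) + of_nat p * z"
    using freshman_dream[OF assms(1) add(1,2)] by blast
  obtain z1 z2 where "z1 \<in> int_span_powers \<zeta>" "z2 \<in> int_span_powers \<zeta>"
    "x ^ (p ^ k) = x + of_nat p * z1" "y ^ (p ^ k) = y + of_nat p * z2"
    using add by blast
  then show ?case using z
    by (intro bexI[of _ "z1 + z2 + z"]) (auto simp: algebra_simps intro: int_span_powers.add)
qed

text \<open>The prime divides \<open>\<beta>\<^sup>2\<close>, hence the Frobenius power of \<open>\<beta>\<close> and so \<open>\<beta>\<close> itself; dividing it out
  lowers the multiplicity by two until a non-integral rational algebraic integer appears.\<close>

lemma neg_sqrt_notin_int_span_powers: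
  assumes p: "prime p" "odd p" and N: "coprime p N" "N > 0" "\<zeta> ^ N = 1"
  shows "\<beta> \<in> int_span_powers \<zeta> \<Longrightarrow> \<beta>\<^sup>2 = - of_nat m \<Longrightarrow> odd (multiplicity p m) \<Longrightarrow> False"
proof (induction m arbitrary: \<beta> rule: less_induct)
  case (less m)
  have p0: "p > 1" using p(1) by (rule prime_gt_1_nat)
  have "multiplicity p m \<noteq> 0" using less.prems(3) by (intro notI) simp
  then have pm: "p dvd m" by (metis not_dvd_imp_multiplicity_0)
  have m0: "m > 0" using less.prems(3) by (intro Nat.gr0I) simp
  define k where "k = totient N"
  have k: "[p ^ k = 1] (mod N)" unfolding k_def using N(1) by (rule euler_theorem)
  \<comment> \<open>Now the odd number \<open>p ^ k\<close> exceeds 1, so \<open>t > 0\<close> below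
    and \<open>\<beta> ^ (p ^ k)\<close> contains at least one factor
    \<open>\<beta>\<^sup>2 = - m\<close>, a multiple of \<open>p\<close>.\<close>
  have k0: "k > 0" using N(2) by (simp add: k_def)
  obtain z where z: "z \<in> int_span_powers \<zeta>" "\<beta> ^ (p ^ k) = \<beta> + of_nat p * z"
    using int_span_powers_frobenius[OF p(1) N(3) k less.prems(1)] by blast
  have oq: "odd (p ^ k)" using p(2) by simp
  then obtain t where t: "p ^ k = 2 * t + 1" by (rule oddE)
  have "t > 0" using t p0 k0 by (intro Nat.gr0I) simp
  obtain s where s: "m = p * s" using pm by blast
  have "\<beta> ^ (p ^ k) = \<beta> * (\<beta>\<^sup>2) ^ t" by (simp add: t power_mult)
  also have "\<dots> = of_nat p * (\<beta> * (- of_nat s * (- of_nat m) ^ (t - 1)))"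
    using \<open>t > 0\<close> by (cases t) (simp_all add: less.prems(2) s)
  finally have e: "\<beta> = of_nat p * (\<beta> * (- of_nat s * (- of_nat m) ^ (t - 1)) - z)"
    using z(2) by (simp add: algebra_simps)
  have ints: "of_nat x \<in> int_span_powers \<zeta>" for x using int_span_powers_of_int[of "int x"] by simp
  define \<gamma> where "\<gamma> = \<beta> * (- of_nat s * (- of_nat m) ^ (t - 1)) - z"
  have \<gamma>: "\<gamma> \<in> int_span_powers \<zeta>" unfolding \<gamma>_def
    using z(1) less.prems(1) ints
    by (intro int_span_powers_diff int_span_powers_mult int_span_powers_power int_span_powers_minus)
  have "\<beta> = of_nat p * \<gamma>" using e unfolding \<gamma>_def .
  then have "of_nat p * (of_nat p * \<gamma>\<^sup>2) = of_nat p * (- of_nat s)"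
    using less.prems(2) by (simp only: s power_mult_distrib power2_eq_square[of "of_nat p"] mult.assoc) simp
  then have sq: "of_nat p * \<gamma>\<^sup>2 = - of_nat s" using p0 by (subst (asm) mult_cancel_left) simp
  show False
  proof (cases "p dvd s")
    case True
    then obtain r where r: "s = p * r" by blast
    have "of_nat p * \<gamma>\<^sup>2 = of_nat p * (- of_nat r)" using sq by (simp add: r)
    then have "\<gamma>\<^sup>2 = - of_nat r" using p0 by (subst (asm) mult_cancel_left) simp
    moreover have "multiplicity p m = Suc (Suc (multiplicity p r))"
      using m0 p0 p(1) by (simp add: s r multiplicity_times_same)
    moreover have "r < m" using m0 less_1_mult[OF p0 p0] by (simp add: s r)
    ultimately show False using less.IH[OF _ \<gamma>] less.prems(3) by simp
  next
    case False
    have "algebraic_int (\<gamma>\<^sup>2)"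
      using int_span_powers_algebraic_int[OF int_span_powers_power[OF \<gamma>] N(3,2)] .
    moreover have g: "\<gamma>\<^sup>2 = of_rat (- of_nat s / of_nat p)"
      using sq p0 by (simp add: of_rat_minus of_rat_divide field_simps)
    ultimately have "\<gamma>\<^sup>2 \<in> \<int>" by (intro rational_algebraic_int_is_int) auto
    then obtain c where "\<gamma>\<^sup>2 = of_int c" by (elim Ints_cases)
    then have "of_int (int p * c) = (of_int (- int s) :: complex)" using sq by simp
    then have "int p * c = - int s" by (simp only: of_int_eq_iff)
    then have "int p dvd int s" by (metis dvd_minus_iff dvd_triv_left)
    then show False using False by simp
  qed
qed

text \<open>Squares are 0 or 1 modulo 4, so \<open>m\<close> is not a square and some prime occurs
  in it with odd multiplicity. As a divisor of \<open>m\<close> this prime is odd and coprime to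
  \<open>N\<close>.\<close>

lemma neg_sqrt_3_mod_4_notin_int_span_powers:
  assumes "m mod 4 = 3" "coprime m N" "N > 0" "\<zeta> ^ N = 1" "\<beta> \<in> int_span_powers \<zeta>"
  shows "\<beta>\<^sup>2 \<noteq> - of_nat m"
proof
  assume \<beta>: "\<beta>\<^sup>2 = - of_nat m"
  have "\<not> is_square m"
  proof
    assume "is_square m"
    then obtain x where "m = x\<^sup>2" unfolding is_nth_power_def by blast
    moreover have "x\<^sup>2 mod 4 \<in> {0, 1}"
    proof (cases "even x")
      case True
      then obtain y where "x = 2 * y" by blast
      then show ?thesis by (simp add: power2_eq_square)
    next
      case False
      then obtain y where "x = 2 * y + 1" by (rule oddE)
      then have "x\<^sup>2 = 4 * (y * y + y) + 1" by (simp add: power2_eq_square)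
      then show ?thesis by simp
    qed
    ultimately show False using assms(1) by simp
  qed
  then have "\<not> (\<forall>p. prime p \<longrightarrow> even (multiplicity p m))"
    by (simp add: is_nth_power_conv_multiplicity_nat)
  then obtain p where p: "prime p" "odd (multiplicity p m)" by blast
  have "odd m" using assms(1) by presburger
  have "multiplicity p m \<noteq> 0" using p(2) by (intro notI) simp
  then have "p dvd m" by (metis not_dvd_imp_multiplicity_0)
  then have "odd p" using \<open>odd m\<close> by (metis dvd_trans)
  moreover have "coprime p N" using \<open>p dvd m\<close> assms(2) by (rule coprime_divisors[OF _ dvd_refl])
  ultimately show False
    using neg_sqrt_notin_int_span_powers[OF p(1) _ _ assms(3,4,5) \<beta> p(2)] by blast
qed

section \<open>Projective dihedral representations\<close>

lemma one_smult_mat: "1 \<cdot>\<^sub>m A = (A :: 'a :: semiring_1 mat)"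
  by (rule eq_matI) auto

lemma mat_adjoint_alt:
  "mat_adjoint A = mat (dim_col A) (dim_row A) (\<lambda>(i, j). conjugate (A $$ (j, i)))"
  unfolding mat_adjoint_def by (rule eq_matI) (auto simp: mat_of_rows_index)

lemma mat_adjoint_carrier: "A \<in> carrier_mat m n \<Longrightarrow> mat_adjoint A \<in> carrier_mat n m"
  by (simp add: mat_adjoint_alt)

lemma mat_adjoint_adjoint: "mat_adjoint (mat_adjoint A) = A"
  by (rule eq_matI) (simp_all add: mat_adjoint_alt)

lemma mat_adjoint_mult:
  fixes A B :: "complex mat"
  assumes "A \<in> carrier_mat m n" "B \<in> carrier_mat n p"
  shows "mat_adjoint (A * B) = mat_adjoint B * mat_adjoint A"
  using assms by (intro eq_matI) (auto simp: mat_adjoint_alt scalar_prod_def mult.commute)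

lemma mat_adjoint_smult:
  fixes A :: "complex mat"
  shows "mat_adjoint (c \<cdot>\<^sub>m A) = cnj c \<cdot>\<^sub>m mat_adjoint A"
  by (rule eq_matI) (simp_all add: mat_adjoint_alt)

lemma mult_mat_vec_adjoint:
  fixes A :: "complex mat"
  assumes "A \<in> carrier_mat m n" "x \<in> carrier_vec n" "y \<in> carrier_vec m"
  shows "(A *\<^sub>v x) \<bullet>c y = x \<bullet>c (mat_adjoint A *\<^sub>v y)"
proof -
  have "(A *\<^sub>v x) \<bullet>c y = (\<Sum>i<m. \<Sum>j<n. A $$ (i, j) * x $ j * cnj (y $ i))"
    using assms by (simp add: scalar_prod_def lessThan_atLeast0 sum_distrib_right)
  also have "\<dots> = (\<Sum>j<n. \<Sum>i<m. A $$ (i, j) * x $ j * cnj (y $ i))" by (rule sum.swap)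
  also have "\<dots> = x \<bullet>c (mat_adjoint A *\<^sub>v y)"
    using assms
    by (simp add: scalar_prod_def lessThan_atLeast0 sum_distrib_left mat_adjoint_alt mult_ac)
  finally show ?thesis .
qed

lemma cscalar_prod_commute:
  fixes x y :: "complex vec"
  assumes "x \<in> carrier_vec n" "y \<in> carrier_vec n"
  shows "cnj (x \<bullet>c y) = y \<bullet>c x"
  using assms by (simp add: scalar_prod_def mult.commute)

lemma unitary_group_mult: "x \<otimes>\<^bsub>unitary_group n\<^esub> y = x * y"
  and unitary_group_one: "\<one>\<^bsub>unitary_group n\<^esub> = 1\<^sub>m n"
  by (simp_all add: unitary_group_def)

lemma unitary_group_carrier_mat: "U \<in> carrier (unitary_group n) \<Longrightarrow> U \<in> carrier_mat n n"
  by (simp add: unitary_group_def)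

lemma mat_adjoint_unitary_group:
  "U \<in> carrier (unitary_group n) \<Longrightarrow> mat_adjoint U \<in> carrier (unitary_group n)"
  by (auto simp: unitary_group_def mat_adjoint_adjoint mat_adjoint_carrier)

lemma group_unitary_group: "group (unitary_group n)"
proof (rule groupI)
  fix x y assume xy: "x \<in> carrier (unitary_group n)" "y \<in> carrier (unitary_group n)"
  then have c: "x \<in> carrier_mat n n" "y \<in> carrier_mat n n"
    "mat_adjoint x \<in> carrier_mat n n" "mat_adjoint y \<in> carrier_mat n n"
    by (auto simp: unitary_group_def mat_adjoint_carrier)
  have "mat_adjoint (x * y) * (x * y) = mat_adjoint y * (mat_adjoint x * x) * y"
    using c by (simp add: mat_adjoint_mult[OF c(1,2)] assoc_mult_mat[of _ n n _ n _ n])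
  moreover have "(x * y) * mat_adjoint (x * y) = x * (y * mat_adjoint y) * mat_adjoint x"
    using c by (simp add: mat_adjoint_mult[OF c(1,2)] assoc_mult_mat[of _ n n _ n _ n])
  ultimately show "x \<otimes>\<^bsub>unitary_group n\<^esub> y \<in> carrier (unitary_group n)"
    using xy c by (simp add: unitary_group_def)
next
  show "\<one>\<^bsub>unitary_group n\<^esub> \<in> carrier (unitary_group n)"
    by (auto simp: unitary_group_def mat_adjoint_alt intro!: eq_matI)
next
  fix x y z
  assume "x \<in> carrier (unitary_group n)" "y \<in> carrier (unitary_group n)" "z \<in> carrier (unitary_group n)"
  then show "x \<otimes>\<^bsub>unitary_group n\<^esub> y \<otimes>\<^bsub>unitary_group n\<^esub> z
      = x \<otimes>\<^bsub>unitary_group n\<^esub> (y \<otimes>\<^bsub>unitary_group n\<^esub> z)"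
    by (auto simp: unitary_group_def intro!: assoc_mult_mat)
next
  fix x assume x: "x \<in> carrier (unitary_group n)"
  then show "\<one>\<^bsub>unitary_group n\<^esub> \<otimes>\<^bsub>unitary_group n\<^esub> x = x"
    by (auto simp: unitary_group_def)
  show "\<exists>y\<in>carrier (unitary_group n). y \<otimes>\<^bsub>unitary_group n\<^esub> x = \<one>\<^bsub>unitary_group n\<^esub>"
    using x mat_adjoint_unitary_group[OF x]
    by (intro bexI[of _ "mat_adjoint x"]) (auto simp: unitary_group_def)
qed

lemma unitary_group_inv:
  assumes "U \<in> carrier (unitary_group n)"
  shows "inv\<^bsub>unitary_group n\<^esub> U = mat_adjoint U"
  using assms mat_adjoint_unitary_group[OF assms]
  by (intro group.inv_equality[OF group_unitary_group]) (auto simp: unitary_group_def)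

lemma smult_unitary_group:
  assumes "U \<in> carrier (unitary_group n)" "cmod c = 1"
  shows "c \<cdot>\<^sub>m U \<in> carrier (unitary_group n)"
proof -
  have U: "U \<in> carrier_mat n n" "mat_adjoint U \<in> carrier_mat n n"
    using assms(1) mat_adjoint_carrier by (auto simp: unitary_group_def)
  have c: "c * cnj c = 1" using assms(2) by (simp add: complex_norm_square[symmetric])
  have "cnj c \<cdot>\<^sub>m mat_adjoint U * (c \<cdot>\<^sub>m U) = (cnj c * c) \<cdot>\<^sub>m (mat_adjoint U * U)"
    "c \<cdot>\<^sub>m U * (cnj c \<cdot>\<^sub>m mat_adjoint U) = (c * cnj c) \<cdot>\<^sub>m (U * mat_adjoint U)"
    using U by (auto simp: mult_smult_assoc_mat[of _ n n _ n] mult_smult_distrib[of _ n n _ n] intro!: eq_matI)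
  then show ?thesis
    using assms c
    by (simp add: unitary_group_def mat_adjoint_smult mult.commute[of "cnj c"] one_smult_mat)
qed

text \<open>Equality in the projective unitary group, as a relation on matrices so that identities
  known up to a phase can be chained and multiplied.\<close>

definition phase_equal :: "complex mat \<Rightarrow> complex mat \<Rightarrow> bool" (infix "\<approx>" 50) where
  "A \<approx> B \<longleftrightarrow> (\<exists>c. cmod c = 1 \<and> A = c \<cdot>\<^sub>m B)"

lemma phase_equal_refl: "A \<approx> A"
  unfolding phase_equal_def by (intro exI[of _ 1]) (auto intro!: eq_matI)

lemma phase_equal_smult: "cmod c = 1 \<Longrightarrow> c \<cdot>\<^sub>m A \<approx> A"
  unfolding phase_equal_def by blast

lemma phase_equal_sym: "A \<approx> B \<Longrightarrow> B \<approx> A"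
proof -
  assume "A \<approx> B"
  then obtain c where c: "cmod c = 1" "A = c \<cdot>\<^sub>m B" unfolding phase_equal_def by blast
  then have "c \<noteq> 0" by auto
  then have "B = inverse c \<cdot>\<^sub>m A" using c(2) by (auto intro!: eq_matI)
  then show ?thesis using c unfolding phase_equal_def by (metis norm_inverse inverse_1)
qed

lemma phase_equal_trans [trans]: "A \<approx> B \<Longrightarrow> B \<approx> C \<Longrightarrow> A \<approx> C"
proof -
  assume "A \<approx> B" "B \<approx> C"
  then obtain c d where "cmod c = 1" "A = c \<cdot>\<^sub>m B" "cmod d = 1" "B = d \<cdot>\<^sub>m C"
    unfolding phase_equal_def by blast
  then have "cmod (c * d) = 1" "A = (c * d) \<cdot>\<^sub>m C"
    by (auto simp: norm_mult intro!: eq_matI)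
  then show ?thesis unfolding phase_equal_def by blast
qed

lemma phase_equal_mult:
  assumes "A \<approx> B" "A' \<approx> B'" "B \<in> carrier_mat n n" "B' \<in> carrier_mat n n"
  shows "A * A' \<approx> B * B'"
proof -
  obtain c d where c: "cmod c = 1" "A = c \<cdot>\<^sub>m B" "cmod d = 1" "A' = d \<cdot>\<^sub>m B'"
    using assms(1,2) unfolding phase_equal_def by blast
  have "A * A' = (c * d) \<cdot>\<^sub>m (B * B')"
    using assms(3,4) unfolding c
    by (auto simp: mult_smult_assoc_mat[of _ n n _ n] mult_smult_distrib[of _ n n _ n] intro!: eq_matI)
  moreover have "cmod (c * d) = 1" using c by (simp add: norm_mult)
  ultimately show ?thesis unfolding phase_equal_def by blast
qed

lemma phase_equal_pow:
  assumes "A \<approx> B" "A \<in> carrier (unitary_group n)" "B \<in> carrier (unitary_group n)"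
  shows "A [^]\<^bsub>unitary_group n\<^esub> (k::nat) \<approx> B [^]\<^bsub>unitary_group n\<^esub> k"
proof -
  interpret group "unitary_group n" by (rule group_unitary_group)
  show ?thesis
  proof (induction k)
    case (Suc k)
    then show ?case
      using assms unitary_group_carrier_mat nat_pow_closed[OF assms(3)]
      by (auto simp: unitary_group_mult intro!: phase_equal_mult)
  qed (simp add: phase_equal_refl)
qed

text \<open>The hypothesis says that conjugation by \<open>W\<close> inverts \<open>U\<close>,
  written without inverses. The innermost triple \<open>U W U\<close> collapses to \<open>W\<close>,
  one layer at a time.\<close>

lemma (in group) reflection_sandwich_pow:
  assumes U: "U \<in> carrier G" and W: "W \<in> carrier G" and UWU: "U \<otimes> W \<otimes> U = W"
  shows "U [^] k \<otimes> W \<otimes> U [^] (k::nat) = W"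
proof (induction k)
  case (Suc k)
  have "U [^] Suc k \<otimes> W \<otimes> U [^] Suc k = U [^] k \<otimes> (U \<otimes> W \<otimes> U) \<otimes> U [^] k"
    using U W nat_pow_Suc2[OF U, of k] by (simp add: m_assoc) (simp flip: m_assoc)
  then show ?case using UWU Suc by simp
qed (use W in simp)

text \<open>For \<open>k \<ge> 0\<close> the sandwich identity is multiplied by
  \<open>U [^] (- k)\<close> from the left; for negative \<open>k\<close> the identity for
  \<open>- k\<close> is multiplied by \<open>U [^] k\<close> from the right.\<close>

lemma (in group) reflection_conj_pow:
  assumes U: "U \<in> carrier G" and W: "W \<in> carrier G" and UWU: "U \<otimes> W \<otimes> U = W"
  shows "W \<otimes> U [^] (k::int) = U [^] (- k) \<otimes> W"
proof -
  have *: "U [^] k \<otimes> W \<otimes> U [^] k = W" if "k \<ge> 0" for k :: int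
    using reflection_sandwich_pow[OF assms, of "nat k"] that by (simp add: int_pow_int[symmetric])
  show ?thesis
  proof (cases "k \<ge> 0")
    case True
    have "U [^] (- k) \<otimes> (U [^] k \<otimes> W \<otimes> U [^] k) = W \<otimes> U [^] k"
      using U W by (simp add: m_assoc[symmetric] int_pow_mult[symmetric])
    then show ?thesis using *[OF True] by simp
  next
    case False
    have "(U [^] (- k) \<otimes> W \<otimes> U [^] (- k)) \<otimes> U [^] k = U [^] (- k) \<otimes> W"
      using U W by (simp add: m_assoc int_pow_mult[symmetric])
    then show ?thesis using *[of "- k"] False by simp
  qed
qed

text \<open>The defining relations of the dihedral group hold exactly, except that the scalar
  \<open>z\<close> remains in the relation for the rotation; all other phases are moved into the
  comparison with \<open>\<pi>\<close>.\<close>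

definition dihedral_normal_form ::
  "nat \<Rightarrow> (nat \<times> bool \<Rightarrow> complex mat) \<Rightarrow> complex \<Rightarrow> complex mat \<Rightarrow> complex mat \<Rightarrow> bool" where
  "dihedral_normal_form n \<pi> z U W \<longleftrightarrow>
     U \<in> carrier (unitary_group n) \<and> W \<in> carrier (unitary_group n) \<and>
     W * W = 1\<^sub>m n \<and> U * W * U = W \<and> U [^]\<^bsub>unitary_group n\<^esub> n = z \<cdot>\<^sub>m 1\<^sub>m n \<and>
     (\<forall>k<n. \<pi> (k, False) \<approx> U [^]\<^bsub>unitary_group n\<^esub> k \<and>
            \<pi> (k, True) \<approx> U [^]\<^bsub>unitary_group n\<^esub> k * W)"

lemma dihedral_mu_tau:
  assumes "n \<ge> 1" "k < n"
  shows "dih_mu n [^]\<^bsub>dihedral n\<^esub> k = (k, False)"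
    and "dih_mu n [^]\<^bsub>dihedral n\<^esub> k \<otimes>\<^bsub>dihedral n\<^esub> dih_tau = (k, True)"
  using dih_mu_pow[OF assms(1), of k] assms by (simp_all add: dihedral_def dih_tau_def)

lemma dihedral_mu_tau_mu:
  assumes "n \<ge> 1"
  shows "dih_mu n \<otimes>\<^bsub>dihedral n\<^esub> dih_tau \<otimes>\<^bsub>dihedral n\<^esub> dih_mu n = dih_tau"
  using assms by (simp add: dihedral_def dih_mu_def dih_tau_def zmod_int mod_simps)

text \<open>Each generator has one free phase. The word \<open>W0 W0\<close> is quadratic in
  \<open>W0\<close> and \<open>U0 W U0\<close> is quadratic in \<open>U0\<close>, so dividing by
  square roots of the resulting scalars normalises both relations. No freedom except signs is left
  for \<open>U ^ n\<close>.\<close>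

lemma dihedral_normal_form_exists:
  assumes n: "n \<ge> 1" and \<pi>: "proj_unitary_rep n \<pi>"
  shows "\<exists>z U W. z\<^sup>2 = 1 \<and> dihedral_normal_form n \<pi> z U W"
proof -
  interpret D: group "dihedral n" using n by (rule dihedral_group)
  interpret G: group "unitary_group n" by (rule group_unitary_group)
  note mult = unitary_group_mult[where n = n] and one = unitary_group_one
  note cm = unitary_group_carrier_mat
  let ?G = "unitary_group n"
  note \<mu>\<tau> = dihedral_presentation(1,2)[OF n]
  have closed: "\<pi> g \<in> carrier ?G" if "g \<in> carrier (dihedral n)" for g
    using \<pi> that unfolding proj_unitary_rep_def by blast
  have hom: "\<pi> (g \<otimes>\<^bsub>dihedral n\<^esub> h) \<approx> \<pi> g * \<pi> h"
    if "g \<in> carrier (dihedral n)" "h \<in> carrier (dihedral n)" for g h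
    using \<pi> that unfolding proj_unitary_rep_def phase_equal_def by blast
  define U0 where "U0 = \<pi> (dih_mu n)"
  define W0 where "W0 = \<pi> dih_tau"
  have U0: "U0 \<in> carrier ?G" and W0: "W0 \<in> carrier ?G"
    unfolding U0_def W0_def using closed \<mu>\<tau> by auto
  have one1: "\<pi> \<one>\<^bsub>dihedral n\<^esub> \<approx> 1\<^sub>m n"
  proof -
    let ?E = "\<pi> \<one>\<^bsub>dihedral n\<^esub>"
    have E: "?E \<in> carrier ?G" using closed by simp
    have "?E \<approx> ?E * ?E" using hom[of "\<one>\<^bsub>dihedral n\<^esub>" "\<one>\<^bsub>dihedral n\<^esub>"] by simp
    then have "?E * inv\<^bsub>?G\<^esub> ?E \<approx> ?E * ?E * inv\<^bsub>?G\<^esub> ?E"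
      using cm[OF E] cm[OF G.inv_closed[OF E]]
      by (intro phase_equal_mult[of _ _ _ _ n] phase_equal_refl) auto
    then show ?thesis using E by (simp add: G.m_assoc phase_equal_sym flip: mult one)
  qed
  have pow: "\<pi> (dih_mu n [^]\<^bsub>dihedral n\<^esub> k) \<approx> U0 [^]\<^bsub>?G\<^esub> k" for k :: nat
  proof (induction k)
    case 0
    show ?case using one1 by (simp add: one)
  next
    case (Suc k)
    have "\<pi> (dih_mu n [^]\<^bsub>dihedral n\<^esub> Suc k) \<approx> \<pi> (dih_mu n [^]\<^bsub>dihedral n\<^esub> k) * U0"
      unfolding U0_def using hom[of "dih_mu n [^]\<^bsub>dihedral n\<^esub> k" "dih_mu n"] \<mu>\<tau> by simp
    also have "\<dots> \<approx> U0 [^]\<^bsub>?G\<^esub> k * U0"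
      using Suc U0 by (intro phase_equal_mult[of _ _ _ _ n] phase_equal_refl) (auto intro!: cm)
    finally show ?case by (simp add: mult)
  qed
  have "U0 [^]\<^bsub>?G\<^esub> n \<approx> 1\<^sub>m n"
    using pow[of n] one1 dihedral_presentation(3)[OF n] phase_equal_sym phase_equal_trans by metis
  have "\<pi> (dih_tau \<otimes>\<^bsub>dihedral n\<^esub> dih_tau) \<approx> W0 * W0"
    unfolding W0_def using hom \<mu>\<tau> by blast
  then have "W0 * W0 \<approx> 1\<^sub>m n"
    using one1 dihedral_presentation(4)[OF n] phase_equal_sym phase_equal_trans by metis
  then obtain e where e: "cmod e = 1" "W0 * W0 = e \<cdot>\<^sub>m 1\<^sub>m n" unfolding phase_equal_def by blast
  then have "e \<noteq> 0" by auto
  \<comment> \<open>The square of this factor cancels the phase \<open>e\<close> of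
    \<open>W0 * W0\<close>.\<close>
  define W where "W = inverse (csqrt e) \<cdot>\<^sub>m W0"
  have ce: "cmod (inverse (csqrt e)) = 1" using e(1) by (simp add: norm_inverse)
  have W: "W \<in> carrier ?G" unfolding W_def using W0 ce by (rule smult_unitary_group)
  have WW0: "W \<approx> W0" unfolding W_def using ce by (rule phase_equal_smult)
  have "W * W = (inverse (csqrt e))\<^sup>2 \<cdot>\<^sub>m (W0 * W0)"
    unfolding W_def using cm[OF W0]
    by (auto simp: mult_smult_assoc_mat[of _ n n _ n] mult_smult_distrib[of _ n n _ n] power2_eq_square
        intro!: eq_matI)
  also have "\<dots> = 1\<^sub>m n"
    using e \<open>e \<noteq> 0\<close> by (auto simp: power_inverse intro!: eq_matI)
  finally have WW: "W * W = 1\<^sub>m n" .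
  have "W0 \<approx> \<pi> (dih_mu n \<otimes>\<^bsub>dihedral n\<^esub> dih_tau) * U0"
    using hom[of "dih_mu n \<otimes>\<^bsub>dihedral n\<^esub> dih_tau" "dih_mu n"] dihedral_mu_tau_mu[OF n] \<mu>\<tau>
    by (simp add: W0_def U0_def)
  also have "\<dots> \<approx> U0 * W0 * U0"
    using hom[of "dih_mu n" dih_tau] \<mu>\<tau> cm[OF U0] cm[OF W0]
    by (intro phase_equal_mult[of _ _ _ _ n] phase_equal_refl) (auto simp: U0_def W0_def)
  also have "\<dots> \<approx> U0 * W * U0"
    using WW0[THEN phase_equal_sym] cm[OF U0] cm[OF W]
    by (intro phase_equal_mult[of _ _ _ _ n] phase_equal_refl) auto
  finally have "U0 * W * U0 \<approx> W" using WW0 phase_equal_sym phase_equal_trans by metis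
  then obtain \<kappa> where \<kappa>: "cmod \<kappa> = 1" "U0 * W * U0 = \<kappa> \<cdot>\<^sub>m W" unfolding phase_equal_def by blast
  then have "\<kappa> \<noteq> 0" by auto
  define U where "U = inverse (csqrt \<kappa>) \<cdot>\<^sub>m U0"
  have c\<kappa>: "cmod (inverse (csqrt \<kappa>)) = 1" using \<kappa>(1) by (simp add: norm_inverse)
  have U: "U \<in> carrier ?G" unfolding U_def using U0 c\<kappa> by (rule smult_unitary_group)
  have UU0: "U \<approx> U0" unfolding U_def using c\<kappa> by (rule phase_equal_smult)
  have "U * W * U = (inverse (csqrt \<kappa>))\<^sup>2 \<cdot>\<^sub>m (U0 * W * U0)"
    unfolding U_def using cm[OF U0] cm[OF W]
    by (auto simp: mult_smult_assoc_mat[of _ n n _ n] mult_smult_distrib[of _ n n _ n] power2_eq_square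
        intro!: eq_matI)
  also have "\<dots> = W"
    using \<kappa> cm[OF W] \<open>\<kappa> \<noteq> 0\<close> by (auto simp: power_inverse intro!: eq_matI)
  finally have UWU: "U * W * U = W" .
  note Upow = phase_equal_pow[OF UU0 U U0]
  obtain z where z: "U [^]\<^bsub>?G\<^esub> n = z \<cdot>\<^sub>m 1\<^sub>m n"
    using phase_equal_trans[OF Upow[of n] \<open>U0 [^]\<^bsub>?G\<^esub> n \<approx> 1\<^sub>m n\<close>] unfolding phase_equal_def by blast
  have "U \<otimes>\<^bsub>?G\<^esub> W \<otimes>\<^bsub>?G\<^esub> U = W" using UWU by (simp add: mult)
  \<comment> \<open>The scalar \<open>z\<close> appears on both sides of \<open>W\<close>, which
    gives \<open>z\<^sup>2 = 1\<close>.\<close>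
  from G.reflection_sandwich_pow[OF U W this, of n] have "(z \<cdot>\<^sub>m 1\<^sub>m n) * W * (z \<cdot>\<^sub>m 1\<^sub>m n) = W" unfolding z by (simp add: mult)
  moreover have "(z \<cdot>\<^sub>m 1\<^sub>m n) * W * (z \<cdot>\<^sub>m 1\<^sub>m n) = z\<^sup>2 \<cdot>\<^sub>m W"
    using cm[OF W]
    by (auto simp: mult_smult_assoc_mat[of _ n n _ n] mult_smult_distrib[of _ n n _ n] power2_eq_square
        intro!: eq_matI)
  ultimately have "z\<^sup>2 \<cdot>\<^sub>m W = W" by simp
  then have "(z\<^sup>2 \<cdot>\<^sub>m W) * W = 1\<^sub>m n" using WW by simp
  then have "z\<^sup>2 \<cdot>\<^sub>m 1\<^sub>m n = (1\<^sub>m n :: complex mat)"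
    using mult_smult_assoc_mat[OF cm[OF W] cm[OF W], of "z\<^sup>2"] WW by simp
  then have "(z\<^sup>2 \<cdot>\<^sub>m 1\<^sub>m n) $$ (0, 0) = (1\<^sub>m n :: complex mat) $$ (0, 0)" by simp
  then have "z\<^sup>2 = 1" using n by simp
  moreover have "dihedral_normal_form n \<pi> z U W"
    unfolding dihedral_normal_form_def
  proof (intro conjI allI impI)
    fix k assume k: "k < n"
    show pF: "\<pi> (k, False) \<approx> U [^]\<^bsub>?G\<^esub> k"
      using pow[of k] Upow[of k] phase_equal_sym phase_equal_trans
      unfolding dihedral_mu_tau(1)[OF n k] by metis
    have "\<pi> (k, True) \<approx> \<pi> (k, False) * W0"
      using hom[of "(k, False)" dih_tau] \<mu>\<tau> k dihedral_mu_tau[OF n k] unfolding W0_def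
      by (simp add: dihedral_def)
    also have "\<dots> \<approx> U [^]\<^bsub>?G\<^esub> k * W"
      using pF WW0 cm[OF W] U by (intro phase_equal_mult[of _ _ _ _ n]) (auto intro: phase_equal_sym cm)
    finally show "\<pi> (k, True) \<approx> U [^]\<^bsub>?G\<^esub> k * W" .
  qed (use U W WW UWU z in auto)
  ultimately show ?thesis by blast
qed

text \<open>Conjugating \<open>\<pi>'\<close> back by \<open>Q\<close> gives a homomorphism
  \<open>\<sigma>\<close> that agrees with \<open>\<pi>\<close> up to phases, and the images of the
  generators under \<open>\<sigma>\<close> satisfy all relations exactly. Normalising
  \<open>\<pi>\<close> directly could yield \<open>z = -1\<close> even here: for odd
  \<open>n\<close>, replacing \<open>U\<close> by \<open>- U\<close> flips the sign of
  \<open>z\<close>.\<close>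

lemma equivalent_strict_rep_normal_form:
  assumes n: "n \<ge> 1" and proj: "proj_unitary_rep n \<pi>"
    and strict: "strict_rep n \<pi>'" and equiv: "equivalent_reps n \<pi> \<pi>'"
  shows "\<exists>U W. dihedral_normal_form n \<pi> 1 U W"
proof -
  interpret D: group "dihedral n" using n by (rule dihedral_group)
  interpret G: group "unitary_group n" by (rule group_unitary_group)
  let ?G = "unitary_group n"
  note mult = unitary_group_mult[where n = n] and one = unitary_group_one
  note cm = unitary_group_carrier_mat
  note \<mu>\<tau> = dihedral_presentation(1,2)[OF n]
  obtain Q where Q: "Q \<in> carrier ?G"
    and conj: "\<And>g. g \<in> carrier (dihedral n) \<Longrightarrow> Q * \<pi> g * mat_adjoint Q \<approx> \<pi>' g"
    using equiv unfolding equivalent_reps_def phase_equal_def by blast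
  have closed: "\<pi> g \<in> carrier ?G" if "g \<in> carrier (dihedral n)" for g
    using proj that unfolding proj_unitary_rep_def by blast
  have \<pi>': "\<pi>' \<in> hom (dihedral n) ?G" using strict unfolding strict_rep_def .
  define \<sigma> where "\<sigma> g = inv\<^bsub>?G\<^esub> Q \<otimes>\<^bsub>?G\<^esub> \<pi>' g \<otimes>\<^bsub>?G\<^esub> Q" for g
  have "\<sigma> \<in> hom (dihedral n) ?G"
  proof (rule homI)
    fix g h assume gh: "g \<in> carrier (dihedral n)" "h \<in> carrier (dihedral n)"
    have "\<sigma> g \<otimes>\<^bsub>?G\<^esub> \<sigma> h
        = inv\<^bsub>?G\<^esub> Q \<otimes>\<^bsub>?G\<^esub> \<pi>' g \<otimes>\<^bsub>?G\<^esub> (Q \<otimes>\<^bsub>?G\<^esub> inv\<^bsub>?G\<^esub> Q) \<otimes>\<^bsub>?G\<^esub> \<pi>' h \<otimes>\<^bsub>?G\<^esub> Q"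
      using Q hom_in_carrier[OF \<pi>'] gh unfolding \<sigma>_def
      by (simp only: G.m_assoc G.m_closed G.inv_closed)
    then show "\<sigma> (g \<otimes>\<^bsub>dihedral n\<^esub> h) = \<sigma> g \<otimes>\<^bsub>?G\<^esub> \<sigma> h"
      using Q hom_in_carrier[OF \<pi>'] gh unfolding \<sigma>_def
      by (simp add: hom_mult[OF \<pi>'] G.m_assoc)
  qed (use Q hom_in_carrier[OF \<pi>'] in \<open>simp add: \<sigma>_def\<close>)
  then interpret \<sigma>: group_hom "dihedral n" ?G \<sigma>
    by unfold_locales
  have \<pi>\<sigma>: "\<pi> g \<approx> \<sigma> g" if g: "g \<in> carrier (dihedral n)" for g
  proof -
    have "inv\<^bsub>?G\<^esub> Q * (Q * \<pi> g * mat_adjoint Q) * Q \<approx> inv\<^bsub>?G\<^esub> Q * \<pi>' g * Q"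
      using Q hom_in_carrier[OF \<pi>' g] conj[OF g]
      by (intro phase_equal_mult[of _ _ _ _ n] phase_equal_refl) (auto intro!: cm simp flip: mult)
    moreover have "inv\<^bsub>?G\<^esub> Q * (Q * \<pi> g * mat_adjoint Q) * Q = \<pi> g"
      using Q closed[OF g]
      by (simp add: G.m_assoc unitary_group_inv[symmetric] flip: mult) (simp flip: G.m_assoc)
    ultimately show ?thesis by (simp add: \<sigma>_def mult)
  qed
  have "dihedral_normal_form n \<pi> 1 (\<sigma> (dih_mu n)) (\<sigma> dih_tau)"
    unfolding dihedral_normal_form_def
  proof (intro conjI allI impI)
    have "\<sigma> (dih_tau \<otimes>\<^bsub>dihedral n\<^esub> dih_tau) = \<sigma> dih_tau * \<sigma> dih_tau"
      using \<mu>\<tau> by (simp add: mult)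
    then show "\<sigma> dih_tau * \<sigma> dih_tau = 1\<^sub>m n"
      using dihedral_presentation(4)[OF n] by (simp add: one)
    have "\<sigma> (dih_mu n \<otimes>\<^bsub>dihedral n\<^esub> dih_tau \<otimes>\<^bsub>dihedral n\<^esub> dih_mu n)
        = \<sigma> (dih_mu n) * \<sigma> dih_tau * \<sigma> (dih_mu n)"
      using \<mu>\<tau> by (simp add: mult)
    then show "\<sigma> (dih_mu n) * \<sigma> dih_tau * \<sigma> (dih_mu n) = \<sigma> dih_tau"
      using dihedral_mu_tau_mu[OF n] by simp
    have "\<sigma> (dih_mu n [^]\<^bsub>dihedral n\<^esub> n) = 1\<^sub>m n"
      using dihedral_presentation(3)[OF n] by (simp add: one)
    then show "\<sigma> (dih_mu n) [^]\<^bsub>?G\<^esub> n = 1 \<cdot>\<^sub>m 1\<^sub>m n"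
      using \<mu>\<tau> by (simp add: \<sigma>.hom_nat_pow) (auto intro!: eq_matI)
    fix k assume k: "k < n"
    then have kc: "(k, b) \<in> carrier (dihedral n)" for b by (simp add: dihedral_def)
    show "\<pi> (k, False) \<approx> \<sigma> (dih_mu n) [^]\<^bsub>?G\<^esub> k"
      using \<pi>\<sigma>[OF kc[of False]] dihedral_mu_tau(1)[OF n k] \<mu>\<tau> by (simp flip: \<sigma>.hom_nat_pow)
    have "\<sigma> (k, True) = \<sigma> (dih_mu n) [^]\<^bsub>?G\<^esub> k * \<sigma> dih_tau"
      using dihedral_mu_tau(2)[OF n k, symmetric] \<mu>\<tau> by (simp add: \<sigma>.hom_nat_pow mult)
    then show "\<pi> (k, True) \<approx> \<sigma> (dih_mu n) [^]\<^bsub>?G\<^esub> k * \<sigma> dih_tau"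
      using \<pi>\<sigma>[OF kc[of True]] by simp
  qed (use \<mu>\<tau> in auto)
  then show ?thesis by blast
qed

lemma (in group) int_pow_mod_order:
  assumes "x \<in> carrier G" "x [^] (n::nat) = \<one>"
  shows "x [^] (k mod int n) = x [^] (k::int)"
proof -
  have "x [^] k = x [^] (int n * (k div int n) + k mod int n)" by simp
  also have "\<dots> = (x [^] int n) [^] (k div int n) \<otimes> x [^] (k mod int n)"
    using assms(1) by (simp only: int_pow_mult int_pow_pow)
  finally show ?thesis using assms by (simp add: int_pow_int)
qed

text \<open>With \<open>z = 1\<close> the relations hold on the nose, so sending
  \<open>\<mu>\<^sup>k \<tau>\<^sup>e\<close> to \<open>U\<^sup>k W\<^sup>e\<close> is a
  homomorphism; it differs from \<open>\<pi>\<close> by phases only, and the identity matrix serves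
  as intertwiner.\<close>

lemma normal_form_imp_equivalent_strict_rep:
  assumes n: "n \<ge> 1" and nf: "dihedral_normal_form n \<pi> 1 U W"
  shows "\<exists>\<pi>'. strict_rep n \<pi>' \<and> equivalent_reps n \<pi> \<pi>'"
proof -
  interpret G: group "unitary_group n" by (rule group_unitary_group)
  let ?G = "unitary_group n"
  note mult = unitary_group_mult[where n = n] and one = unitary_group_one
  note cm = unitary_group_carrier_mat
  have U: "U \<in> carrier ?G" and W: "W \<in> carrier ?G" and WW: "W \<otimes>\<^bsub>?G\<^esub> W = \<one>\<^bsub>?G\<^esub>"
    and UWU: "U \<otimes>\<^bsub>?G\<^esub> W \<otimes>\<^bsub>?G\<^esub> U = W"
    and Un: "U [^]\<^bsub>?G\<^esub> n = \<one>\<^bsub>?G\<^esub>"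
    and \<pi>: "\<And>k. k < n \<Longrightarrow> \<pi> (k, False) \<approx> U [^]\<^bsub>?G\<^esub> k"
      "\<And>k. k < n \<Longrightarrow> \<pi> (k, True) \<approx> U [^]\<^bsub>?G\<^esub> k * W"
    using nf unfolding dihedral_normal_form_def by (auto simp: mult one intro!: eq_matI)
  \<comment> \<open>Integer exponents accommodate the differences in the group law; the reduction
    modulo \<open>n\<close> there is absorbed by \<open>U [^] n\<close> being the identity.\<close>
  define \<sigma> where
    "\<sigma> = (\<lambda>(k, e). U [^]\<^bsub>?G\<^esub> int k \<otimes>\<^bsub>?G\<^esub> (if e then W else \<one>\<^bsub>?G\<^esub>))"
  note WU = G.reflection_conj_pow[OF U W UWU]
  have "\<sigma> \<in> hom (dihedral n) ?G"
  proof (rule homI)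
    fix g h assume "g \<in> carrier (dihedral n)" "h \<in> carrier (dihedral n)"
    then obtain k e l f where gh: "g = (k, e)" "h = (l, f)" by (cases g; cases h)
    have m: "U [^]\<^bsub>?G\<^esub> (int (nat (i mod int n))) = U [^]\<^bsub>?G\<^esub> i" for i :: int
      using n G.int_pow_mod_order[OF U Un] by simp
    have comm: "W \<otimes>\<^bsub>?G\<^esub> (U [^]\<^bsub>?G\<^esub> i \<otimes>\<^bsub>?G\<^esub> X) = U [^]\<^bsub>?G\<^esub> (- i) \<otimes>\<^bsub>?G\<^esub> (W \<otimes>\<^bsub>?G\<^esub> X)"
      if "X \<in> carrier ?G" for i :: int and X
      using U W that by (simp add: G.m_assoc[symmetric] WU)
    show "\<sigma> (g \<otimes>\<^bsub>dihedral n\<^esub> h) = \<sigma> g \<otimes>\<^bsub>?G\<^esub> \<sigma> h"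
      unfolding gh \<sigma>_def using U W
      by (cases e; cases f; simp add: dihedral_def m G.m_assoc comm WU WW del: G.int_pow_neg int_nat_eq)
        (simp_all add: G.m_assoc[symmetric] G.int_pow_mult[symmetric] del: G.int_pow_neg)
  qed (use U W in \<open>auto simp: \<sigma>_def\<close>)
  moreover have "equivalent_reps n \<pi> \<sigma>"
    unfolding equivalent_reps_def
  proof (intro bexI ballI)
    fix g assume "g \<in> carrier (dihedral n)"
    then obtain k e where g: "g = (k, e)" "k < n" by (cases g) (auto simp: dihedral_def)
    have "\<pi> g \<approx> \<sigma> g"
      using \<pi>[OF g(2)] U W g(1) by (cases e) (auto simp: \<sigma>_def int_pow_int simp flip: mult)
    moreover have "\<sigma> g \<in> carrier_mat n n"
      using U W by (intro cm) (auto simp: \<sigma>_def g)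
    ultimately have "\<pi> g \<in> carrier_mat n n" unfolding phase_equal_def by auto
    moreover have "mat_adjoint (1\<^sub>m n) = (1\<^sub>m n :: complex mat)"
      by (rule eq_matI) (auto simp: mat_adjoint_alt)
    ultimately show "\<exists>c. cmod c = 1 \<and> 1\<^sub>m n * \<pi> g * mat_adjoint (1\<^sub>m n) = c \<cdot>\<^sub>m \<sigma> g"
      using \<open>\<pi> g \<approx> \<sigma> g\<close> unfolding phase_equal_def by simp
  qed (use G.one_closed in \<open>simp add: one\<close>)
  ultimately show ?thesis unfolding strict_rep_def by blast
qed

text \<open>The other root \<open>z = 1\<close> would make \<open>\<pi>\<close> equivalent to a
  strict representation.\<close>

lemma genuine_configuration_normal_form:
  assumes n: "n \<ge> 1" and "genuine_projective_configuration n \<pi> v"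
  shows "\<exists>U W. dihedral_normal_form n \<pi> (-1) U W"
proof -
  have proj: "proj_unitary_rep n \<pi>" and no: "\<not> (\<exists>\<pi>'. strict_rep n \<pi>' \<and> equivalent_reps n \<pi> \<pi>')"
    using assms(2)
    unfolding genuine_projective_configuration_def strict_configuration_def dihedral_configuration_def
    by blast+
  obtain z U W where z: "z\<^sup>2 = 1" and nf: "dihedral_normal_form n \<pi> z U W"
    using dihedral_normal_form_exists[OF n proj] by blast
  have "z \<noteq> 1" using normal_form_imp_equivalent_strict_rep[OF n, of \<pi> U W] nf no by blast
  then have "z = -1" using z by (simp add: power2_eq_1_iff)
  then show ?thesis using nf by blast
qed

section \<open>Orbit vectors\<close>

lemma smult_mult_mat_vec:
  fixes A :: "'a :: comm_semiring_1 mat"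
  shows "dim_vec x = dim_col A \<Longrightarrow> (c \<cdot>\<^sub>m A) *\<^sub>v x = c \<cdot>\<^sub>v (A *\<^sub>v x)"
  by (rule eq_vecI) (auto simp: scalar_prod_def sum_distrib_left mult.assoc)

lemma distinct_basis_iff_det:
  fixes ws :: "complex vec list"
  assumes ws: "set ws \<subseteq> carrier_vec n" "length ws = n"
  shows "distinct ws \<and> vectorspace.basis class_ring (module_vec TYPE(complex) n) (set ws)
    \<longleftrightarrow> det (mat_of_cols n ws) \<noteq> 0"
proof -
  interpret vec_space "TYPE(complex)" n .
  let ?M = "mat_of_cols n ws"
  have M: "?M \<in> carrier_mat n n" using ws by auto
  have cols: "cols ?M = ws" using ws by (simp add: cols_mat_of_cols)
  show ?thesis
  proof
    assume *: "distinct ws \<and> basis (set ws)"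
    then have "lin_indpt (set (cols ?M))" unfolding basis_def cols by blast
    then have "rank ?M = n" using * M by (intro lin_indpt_full_rank) (auto simp: cols)
    then show "det ?M \<noteq> 0" using det_rank_iff[OF M] by simp
  next
    assume "det ?M \<noteq> 0"
    then have r: "rank ?M = n" using det_rank_iff[OF M] by simp
    then have d: "distinct ws" using non_distinct_low_rank[OF M] cols by fastforce
    then have "lin_indpt (set ws)" using full_rank_lin_indpt[OF M r] cols by simp
    then have "basis (set ws)"
      using ws d by (intro dim_li_is_basis) (auto simp: dim_is_n distinct_card)
    then show "distinct ws \<and> basis (set ws)" using d by blast
  qed
qed

text \<open>Indexed by numbers rather than stated for a set, so a repeated vector counts as a
  dependence; written in coordinates so that it is the kernel condition of a square matrix.\<close>

definition lin_indep_family :: "nat \<Rightarrow> (nat \<Rightarrow> complex vec) \<Rightarrow> bool" where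
  "lin_indep_family n f \<longleftrightarrow>
     (\<forall>c. (\<forall>i<n. (\<Sum>k<n. c k * f k $ i) = 0) \<longrightarrow> (\<forall>k<n. c k = 0))"

lemma lin_indep_family_iff_det:
  "lin_indep_family n f \<longleftrightarrow> det (mat n n (\<lambda>(i, k). f k $ i)) \<noteq> 0" (is "_ \<longleftrightarrow> det ?M \<noteq> 0")
proof -
  have M: "?M \<in> carrier_mat n n" by simp
  have mult: "?M *\<^sub>v vec n c = 0\<^sub>v n \<longleftrightarrow> (\<forall>i<n. (\<Sum>k<n. c k * f k $ i) = 0)" for c
    by (auto simp: vec_eq_iff scalar_prod_def lessThan_atLeast0 mult.commute)
  have "det ?M = 0 \<longleftrightarrow> (\<exists>c. vec n c \<noteq> 0\<^sub>v n \<and> ?M *\<^sub>v vec n c = 0\<^sub>v n)"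
  proof -
    have "(\<exists>v. v \<in> carrier_vec n \<and> v \<noteq> 0\<^sub>v n \<and> ?M *\<^sub>v v = 0\<^sub>v n)
        \<longleftrightarrow> (\<exists>c. vec n c \<noteq> 0\<^sub>v n \<and> ?M *\<^sub>v vec n c = 0\<^sub>v n)"
    proof safe
      fix v assume "v \<in> carrier_vec n" "v \<noteq> 0\<^sub>v n" "?M *\<^sub>v v = 0\<^sub>v n"
      moreover from this(1) have "v = vec n (\<lambda>i. v $ i)" by (intro eq_vecI) auto
      ultimately show "\<exists>c. vec n c \<noteq> 0\<^sub>v n \<and> ?M *\<^sub>v vec n c = 0\<^sub>v n" by metis
    qed (use vec_carrier in blast)
    then show ?thesis using det_0_iff_vec_prod_zero[OF M] by simp
  qed
  also have "\<dots> \<longleftrightarrow> \<not> lin_indep_family n f"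
    unfolding lin_indep_family_def mult by (auto simp: vec_eq_iff)
  finally show ?thesis by blast
qed

lemma lin_indep_family_scale:
  assumes "\<And>k. k < n \<Longrightarrow> d k \<noteq> 0 \<and> f k = d k \<cdot>\<^sub>v g k" "\<And>k. k < n \<Longrightarrow> g k \<in> carrier_vec n"
  shows "lin_indep_family n f \<longleftrightarrow> lin_indep_family n g"
proof -
  have 1: "(\<Sum>k<n. c k * f k $ i) = (\<Sum>k<n. (c k * d k) * g k $ i)" if "i < n" for c i
  proof (rule sum.cong[OF refl])
    fix k assume "k \<in> {..<n}"
    then have "f k = d k \<cdot>\<^sub>v g k" "dim_vec (g k) = n" using assms by auto
    then show "c k * f k $ i = (c k * d k) * g k $ i" using that by simp
  qed
  show ?thesis
  proof
    assume f: "lin_indep_family n f"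
    show "lin_indep_family n g"
      unfolding lin_indep_family_def
    proof (intro allI impI)
      fix c k assume c: "\<forall>i<n. (\<Sum>k<n. c k * g k $ i) = 0" and k: "k < n"
      have "\<forall>i<n. (\<Sum>k<n. (c k / d k) * f k $ i) = 0"
        using 1[of _ "\<lambda>k. c k / d k"] c assms(1) by simp
      from f[unfolded lin_indep_family_def, THEN spec, THEN mp, OF this]
      have "c k / d k = 0" using k by simp
      then show "c k = 0" using assms(1)[OF k] by simp
    qed
  next
    assume g: "lin_indep_family n g"
    show "lin_indep_family n f"
      unfolding lin_indep_family_def
    proof (intro allI impI)
      fix c k assume c: "\<forall>i<n. (\<Sum>k<n. c k * f k $ i) = 0" and k: "k < n"
      then have "\<forall>i<n. (\<Sum>k<n. (c k * d k) * g k $ i) = 0" using 1 by simp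
      from g[unfolded lin_indep_family_def, THEN spec, THEN mp, OF this]
      have "c k * d k = 0" using k by simp
      then show "c k = 0" using assms(1)[OF k] by simp
    qed
  qed
qed

lemma regular_configuration_iff:
  assumes n: "n \<ge> 1" and v: "v \<in> carrier_vec n" "u 0 = v"
    and u: "\<And>k. k < n \<Longrightarrow> u k \<in> carrier_vec n"
    and \<pi>: "\<And>k. k < n \<Longrightarrow> \<exists>c. cmod c = 1 \<and> \<pi> (k, False) *\<^sub>v v = c \<cdot>\<^sub>v u k"
  shows "regular_configuration n \<pi> v \<longleftrightarrow> lin_indep_family n u"
proof -
  \<comment> \<open>Regularity lists \<open>v\<close> itself in first place, while
    \<open>\<pi>\<close> at the identity is only a phase times the identity matrix.\<close>
  define f where "f k = (if k = 0 then v else \<pi> (k, False) *\<^sub>v v)" for k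
  let ?ws = "v # map (\<lambda>k. \<pi> (dih_mu n [^]\<^bsub>dihedral n\<^esub> k) *\<^sub>v v) [1..<n]"
  have ws: "?ws = map f [0..<n]"
    using n by (auto simp: upt_conv_Cons[of 0 n] f_def dihedral_mu_tau(1)[OF n])
  have "\<exists>c. c \<noteq> 0 \<and> f k = c \<cdot>\<^sub>v u k" if k: "k < n" for k
  proof (cases "k = 0")
    case True
    then show ?thesis using v by (intro exI[of _ 1]) (auto simp: f_def)
  next
    case False
    obtain c where "cmod c = 1" "\<pi> (k, False) *\<^sub>v v = c \<cdot>\<^sub>v u k" using \<pi>[OF k] by blast
    then show ?thesis using False by (intro exI[of _ c]) (auto simp: f_def)
  qed
  then obtain d where d: "\<And>k. k < n \<Longrightarrow> d k \<noteq> 0 \<and> f k = d k \<cdot>\<^sub>v u k" by metis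
  have fc: "f k \<in> carrier_vec n" if "k < n" for k using d[OF that] u[OF that] by simp
  have "regular_configuration n \<pi> v \<longleftrightarrow> det (mat_of_cols n ?ws) \<noteq> 0"
    unfolding regular_configuration_def Let_def ws
    using fc by (intro distinct_basis_iff_det) auto
  also have "mat_of_cols n ?ws = mat n n (\<lambda>(i, k). f k $ i)"
    unfolding ws by (rule eq_matI) (auto simp: mat_of_cols_index)
  also have "det \<dots> \<noteq> 0 \<longleftrightarrow> lin_indep_family n f" by (simp add: lin_indep_family_iff_det)
  also have "\<dots> \<longleftrightarrow> lin_indep_family n u" using d u by (rule lin_indep_family_scale)
  finally show ?thesis .
qed

lemma lin_indep_family_spans:
  assumes "lin_indep_family n f" "x \<in> carrier_vec n"
  obtains c where "x = vec n (\<lambda>i. \<Sum>k<n. c k * f k $ i)"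
proof -
  let ?M = "mat n n (\<lambda>(i, k). f k $ i)"
  have M: "?M \<in> carrier_mat n n" by simp
  have "det ?M \<noteq> 0" using assms(1) by (simp add: lin_indep_family_iff_det)
  from det_non_zero_imp_unit[OF M this, of "()"]
  obtain B where B: "B \<in> carrier_mat n n" "?M * B = 1\<^sub>m n"
    unfolding Units_def ring_mat_def by auto
  have "x = ?M *\<^sub>v (B *\<^sub>v x)"
    using B assms(2) by (simp flip: assoc_mult_mat_vec[OF M B(1) assms(2)])
  also have "\<dots> = vec n (\<lambda>i. \<Sum>k<n. (B *\<^sub>v x) $ k * f k $ i)"
    using B(1) by (intro eq_vecI) (auto simp: scalar_prod_def lessThan_atLeast0 mult.commute)
  finally show thesis by (rule that)
qed

lemma sum_vec_cscalar_left:
  fixes y :: "complex vec"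
  assumes "y \<in> carrier_vec n" "\<And>k. k < m \<Longrightarrow> f k \<in> carrier_vec n"
  shows "vec n (\<lambda>i. \<Sum>k<m. c k * f k $ i) \<bullet>c y = (\<Sum>k<m. c k * (f k \<bullet>c y))"
proof -
  have "vec n (\<lambda>i. \<Sum>k<m. c k * f k $ i) \<bullet>c y = (\<Sum>i<n. \<Sum>k<m. c k * f k $ i * cnj (y $ i))"
    using assms by (simp add: scalar_prod_def lessThan_atLeast0 sum_distrib_right)
  also have "\<dots> = (\<Sum>k<m. \<Sum>i<n. c k * f k $ i * cnj (y $ i))" by (rule sum.swap)
  also have "\<dots> = (\<Sum>k<m. c k * (f k \<bullet>c y))"
    using assms by (intro sum.cong)
      (auto simp: scalar_prod_def lessThan_atLeast0 sum_distrib_left mult.assoc)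
  finally show ?thesis .
qed

lemma sum_vec_cscalar_right:
  fixes y :: "complex vec"
  assumes "y \<in> carrier_vec n" "\<And>k. k < m \<Longrightarrow> f k \<in> carrier_vec n"
  shows "y \<bullet>c vec n (\<lambda>i. \<Sum>k<m. c k * f k $ i) = (\<Sum>k<m. cnj (c k) * (y \<bullet>c f k))"
proof -
  have "y \<bullet>c vec n (\<lambda>i. \<Sum>k<m. c k * f k $ i) = cnj (vec n (\<lambda>i. \<Sum>k<m. c k * f k $ i) \<bullet>c y)"
    by (rule cscalar_prod_commute[symmetric]) (use assms in auto)
  also have "\<dots> = (\<Sum>k<m. cnj (c k) * cnj (f k \<bullet>c y))"
    using assms by (simp add: sum_vec_cscalar_left)
  also have "\<dots> = (\<Sum>k<m. cnj (c k) * (y \<bullet>c f k))"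
    using assms by (intro sum.cong) (auto simp: cscalar_prod_commute[of _ n])
  finally show ?thesis .
qed

lemma lin_indep_family_orthogonal:
  assumes "lin_indep_family n f" "\<And>k. k < n \<Longrightarrow> f k \<in> carrier_vec n" "x \<in> carrier_vec n"
    and "\<And>k. k < n \<Longrightarrow> x \<bullet>c f k = 0"
  shows "x = 0\<^sub>v n"
proof -
  obtain c where "x = vec n (\<lambda>i. \<Sum>k<n. c k * f k $ i)"
    using lin_indep_family_spans[OF assms(1,3)] .
  then have "x \<bullet>c x = (\<Sum>k<n. cnj (c k) * (x \<bullet>c f k))"
    using sum_vec_cscalar_right[OF assms(3,2)] by simp
  then show ?thesis using assms(3,4) by simp
qed

text \<open>A combination orthogonal to every \<open>f j\<close> is orthogonal to itself, hence
  zero. Independence is thereby a property of the inner products alone; for the orbit it becomes a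
  statement about \<open>a\<close>.\<close>

lemma lin_indep_family_iff_gram:
  assumes f: "\<And>k. k < n \<Longrightarrow> f k \<in> carrier_vec n"
  shows "lin_indep_family n f \<longleftrightarrow>
    (\<forall>c. (\<forall>j<n. (\<Sum>k<n. c k * (f k \<bullet>c f j)) = 0) \<longrightarrow> (\<forall>k<n. c k = 0))"
proof -
  have "(\<forall>i<n. (\<Sum>k<n. c k * f k $ i) = 0) \<longleftrightarrow> (\<forall>j<n. (\<Sum>k<n. c k * (f k \<bullet>c f j)) = 0)" for c
  proof -
    let ?y = "vec n (\<lambda>i. \<Sum>k<n. c k * f k $ i)"
    have y: "?y \<in> carrier_vec n" by simp
    have 1: "?y \<bullet>c f j = (\<Sum>k<n. c k * (f k \<bullet>c f j))" if "j < n" for j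
      using f that by (intro sum_vec_cscalar_left) auto
    have "?y \<bullet>c ?y = (\<Sum>k<n. cnj (c k) * (?y \<bullet>c f k))"
      using f y by (intro sum_vec_cscalar_right) auto
    then have "?y = 0\<^sub>v n" if "\<forall>j<n. (\<Sum>k<n. c k * (f k \<bullet>c f j)) = 0"
      using that y by (simp add: 1)
    moreover have "?y \<bullet>c f j = 0" if "?y = 0\<^sub>v n" "j < n" for j
      unfolding that using f[OF that(2)] by simp
    moreover have "?y = 0\<^sub>v n \<longleftrightarrow> (\<forall>i<n. (\<Sum>k<n. c k * f k $ i) = 0)"
      by (auto simp: vec_eq_iff)
    ultimately show ?thesis using 1 by (intro iffI) auto
  qed
  then show ?thesis unfolding lin_indep_family_def by simp
qed

text \<open>Here \<open>u k\<close> is \<open>U\<^sup>k v\<close> and \<open>w k\<close> is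
  \<open>U\<^sup>k W v\<close>. Indices range over all integers, so that wrapping around is
  multiplication by \<open>z\<close>. The difference is reversed in \<open>ww\<close> because moving
  \<open>W\<close> across a power of \<open>U\<close> inverts it.\<close>

locale dihedral_orbit =
  fixes n :: nat and z :: complex and u w :: "int \<Rightarrow> complex vec" and a b :: "int \<Rightarrow> complex"
  assumes n: "n \<ge> 1" and z: "z\<^sup>2 = 1"
    and u_carrier: "u k \<in> carrier_vec n" and w_carrier: "w k \<in> carrier_vec n"
    and uu: "u l \<bullet>c u k = a (l - k)" and wu: "w l \<bullet>c u k = b (l - k)"
    and ww: "w l \<bullet>c w k = a (k - l)"
    and a_0: "a 0 = 1" and a_cnj: "cnj (a k) = a (- k)" and b_cnj: "cnj (b k) = b k"
    and a_period: "a (k + int n) = z * a k" and b_period: "b (k + int n) = z * b k"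

lemma normal_form_orbit:
  assumes n: "n \<ge> 1" and z: "z\<^sup>2 = 1" and nf: "dihedral_normal_form n \<pi> z U W"
    and v: "v \<in> carrier_vec n" "v \<bullet>c v = 1"
  shows "\<exists>u w a b. dihedral_orbit n z u w a b \<and> u 0 = v \<and>
    (\<forall>k<n. (\<exists>c. cmod c = 1 \<and> \<pi> (k, False) *\<^sub>v v = c \<cdot>\<^sub>v u (int k)) \<and>
           (\<exists>c. cmod c = 1 \<and> \<pi> (k, True) *\<^sub>v v = c \<cdot>\<^sub>v w (int k)))"
proof -
  interpret G: group "unitary_group n" by (rule group_unitary_group)
  let ?G = "unitary_group n"
  note mult = unitary_group_mult[where n = n] and one = unitary_group_one
  note cm = unitary_group_carrier_mat
  have U: "U \<in> carrier ?G" and W: "W \<in> carrier ?G" and WW: "W \<otimes>\<^bsub>?G\<^esub> W = \<one>\<^bsub>?G\<^esub>"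
    and UWU: "U \<otimes>\<^bsub>?G\<^esub> W \<otimes>\<^bsub>?G\<^esub> U = W"
    and Un: "U [^]\<^bsub>?G\<^esub> n = z \<cdot>\<^sub>m 1\<^sub>m n"
    and \<pi>: "\<And>k. k < n \<Longrightarrow> \<pi> (k, False) \<approx> U [^]\<^bsub>?G\<^esub> k"
      "\<And>k. k < n \<Longrightarrow> \<pi> (k, True) \<approx> U [^]\<^bsub>?G\<^esub> k * W"
    using nf unfolding dihedral_normal_form_def by (auto simp: mult one)
  define p where "p k = U [^]\<^bsub>?G\<^esub> k" for k :: int
  have p: "p k \<in> carrier ?G" for k using U by (simp add: p_def)
  note pm = cm[OF p] and Wm = cm[OF W]
  have p_add: "p k * p l = p (k + l)" for k l
    using U by (simp add: p_def G.int_pow_mult flip: mult)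
  have p_adj: "mat_adjoint (p k) = p (- k)" for k
    using U unitary_group_inv[OF p, of k] by (simp add: p_def G.int_pow_neg)
  \<comment> \<open>A unitary involution is self-adjoint; both the reality of \<open>b\<close> and
    the reversed difference in \<open>ww\<close> rest on this.\<close>
  have W_adj: "mat_adjoint W = W"
    using unitary_group_inv[OF W] G.inv_equality[OF WW W W] by simp
  have p_W: "W * p k = p (- k) * W" for k
    using G.reflection_conj_pow[OF U W UWU, of k] by (simp add: p_def mult)
  have WWm: "W * W = 1\<^sub>m n" using WW by (simp add: mult one)
  have p_0: "p 0 = 1\<^sub>m n" by (simp add: p_def one)
  have p_n: "p (k + int n) *\<^sub>v x = z \<cdot>\<^sub>v (p k *\<^sub>v x)" if "x \<in> carrier_vec n" for k x
  proof -
    have "p (k + int n) = p k * (z \<cdot>\<^sub>m 1\<^sub>m n)"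
      using p_add[of k "int n"] Un by (simp add: p_def int_pow_int)
    also have "\<dots> = z \<cdot>\<^sub>m p k" using pm[of k] by (simp add: mult_smult_distrib[OF pm one_carrier_mat])
    finally show ?thesis using pm[of k] that by (simp add: smult_mult_mat_vec)
  qed
  have move: "(p l *\<^sub>v x) \<bullet>c (p k *\<^sub>v y) = (p (l - k) *\<^sub>v x) \<bullet>c y"
    if "x \<in> carrier_vec n" "y \<in> carrier_vec n" for x y k l
  proof -
    have "(p (l - k) *\<^sub>v x) \<bullet>c y = (p (- k) *\<^sub>v (p l *\<^sub>v x)) \<bullet>c y"
      using pm that p_add[of "- k" l] by (simp flip: assoc_mult_mat_vec[OF pm pm])
    also have "\<dots> = (p l *\<^sub>v x) \<bullet>c (p k *\<^sub>v y)"
      using mult_mat_vec_adjoint[OF pm[of "- k"], of "p l *\<^sub>v x" y]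
        mult_mat_vec_carrier[OF pm that(1)] that by (simp add: p_adj)
    finally show ?thesis by simp
  qed
  define u where "u k = p k *\<^sub>v v" for k
  define w where "w k = p k *\<^sub>v (W *\<^sub>v v)" for k
  define a where "a k = (p k *\<^sub>v v) \<bullet>c v" for k
  define b where "b k = (p k *\<^sub>v (W *\<^sub>v v)) \<bullet>c v" for k
  have Wv: "W *\<^sub>v v \<in> carrier_vec n" using Wm v(1) by simp
  have pv: "p k *\<^sub>v v \<in> carrier_vec n" for k using pm[of k] v(1) by simp
  have W_adj_prod: "(W *\<^sub>v x) \<bullet>c y = x \<bullet>c (W *\<^sub>v y)"
    if "x \<in> carrier_vec n" "y \<in> carrier_vec n" for x y
    using mult_mat_vec_adjoint[OF Wm that] by (simp add: W_adj)
  have Wp: "W *\<^sub>v (p k *\<^sub>v x) = p (- k) *\<^sub>v (W *\<^sub>v x)" if "x \<in> carrier_vec n" for k x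
    using p_W[of k] by (simp flip: assoc_mult_mat_vec[OF Wm pm that] assoc_mult_mat_vec[OF pm Wm that])
  have WWx: "W *\<^sub>v (W *\<^sub>v x) = x" if "x \<in> carrier_vec n" for x
    using that WWm by (simp flip: assoc_mult_mat_vec[OF Wm Wm that])
  have "dihedral_orbit n z u w a b"
  proof
    show "u k \<in> carrier_vec n" "w k \<in> carrier_vec n" for k
      using pm[of k] v(1) Wv unfolding u_def w_def by auto
    show "u l \<bullet>c u k = a (l - k)" "w l \<bullet>c u k = b (l - k)" for k l
      unfolding u_def w_def a_def b_def using move v(1) Wv by auto
    show "w l \<bullet>c w k = a (k - l)" for k l
    proof -
      have "w l \<bullet>c w k = (p (l - k) *\<^sub>v (W *\<^sub>v v)) \<bullet>c (W *\<^sub>v v)"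
        unfolding w_def using move[OF Wv Wv] .
      also have "\<dots> = (W *\<^sub>v (p (l - k) *\<^sub>v (W *\<^sub>v v))) \<bullet>c v"
        using W_adj_prod[OF _ v(1)] pm[of "l - k"] Wv by simp
      finally show ?thesis unfolding a_def using Wp[OF Wv] WWx[OF v(1)] by simp
    qed
    show "a 0 = 1" using v by (simp add: a_def p_0)
    show "cnj (a k) = a (- k)" for k
    proof -
      have "cnj (a k) = v \<bullet>c (p k *\<^sub>v v)" unfolding a_def using pv v(1) by (rule cscalar_prod_commute)
      also have "\<dots> = (p 0 *\<^sub>v v) \<bullet>c (p k *\<^sub>v v)" using v(1) by (simp add: p_0)
      also have "\<dots> = a (- k)" unfolding a_def using move[OF v(1) v(1), of 0 k] by simp
      finally show ?thesis .
    qed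
    show "cnj (b k) = b k" for k
    proof -
      have "cnj (b k) = v \<bullet>c (p k *\<^sub>v (W *\<^sub>v v))"
        unfolding b_def using pm[of k] Wv v(1) by (intro cscalar_prod_commute) auto
      also have "\<dots> = (p 0 *\<^sub>v v) \<bullet>c (p k *\<^sub>v (W *\<^sub>v v))" using v(1) by (simp add: p_0)
      also have "\<dots> = (p (- k) *\<^sub>v v) \<bullet>c (W *\<^sub>v v)" using move[OF v(1) Wv, of 0 k] by simp
      also have "\<dots> = (W *\<^sub>v (p (- k) *\<^sub>v v)) \<bullet>c v" using W_adj_prod[OF pv v(1)] by simp
      also have "\<dots> = b k" unfolding b_def using Wp[OF v(1)] by simp
      finally show ?thesis .
    qed
    show "a (k + int n) = z * a k" "b (k + int n) = z * b k" for k
      unfolding a_def b_def using p_n[OF v(1)] p_n[OF Wv] pm[of k] v(1) Wv by auto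
  qed (use n z in auto)
  moreover have "u 0 = v" using v by (simp add: u_def p_0)
  moreover have "(\<exists>c. cmod c = 1 \<and> \<pi> (k, False) *\<^sub>v v = c \<cdot>\<^sub>v u (int k)) \<and>
           (\<exists>c. cmod c = 1 \<and> \<pi> (k, True) *\<^sub>v v = c \<cdot>\<^sub>v w (int k))" if k: "k < n" for k
  proof -
    obtain c d where c: "cmod c = 1" "\<pi> (k, False) = c \<cdot>\<^sub>m p (int k)"
      and d: "cmod d = 1" "\<pi> (k, True) = d \<cdot>\<^sub>m (p (int k) * W)"
      using \<pi>[OF k] unfolding phase_equal_def by (auto simp: p_def int_pow_int)
    have "\<pi> (k, False) *\<^sub>v v = c \<cdot>\<^sub>v u (int k)"
      unfolding c u_def using pm[of "int k"] v(1) by (simp add: smult_mult_mat_vec)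
    moreover have "\<pi> (k, True) *\<^sub>v v = d \<cdot>\<^sub>v w (int k)"
      unfolding d w_def using pm[of "int k"] Wm v(1)
      by (simp add: smult_mult_mat_vec assoc_mult_mat_vec[OF pm Wm])
    ultimately show ?thesis using c(1) d(1) by blast
  qed
  ultimately show ?thesis by blast
qed

section \<open>Frames generated by dihedral orbits\<close>

lemma cscalar_prod_lincomb_left:
  fixes x y t :: "complex vec"
  assumes "x \<in> carrier_vec n" "y \<in> carrier_vec n" "t \<in> carrier_vec n"
  shows "(x + c \<cdot>\<^sub>v y) \<bullet>c t = x \<bullet>c t + c * (y \<bullet>c t)"
  using assms by (simp add: add_scalar_prod_distrib[of _ n])

lemma cscalar_prod_lincomb_right:
  fixes x y t :: "complex vec"
  assumes "x \<in> carrier_vec n" "y \<in> carrier_vec n" "t \<in> carrier_vec n"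
  shows "t \<bullet>c (x + c \<cdot>\<^sub>v y) = t \<bullet>c x + cnj c * (t \<bullet>c y)"
  using assms
  by (simp add: conjugate_add_vec[of _ n] conjugate_smult_vec scalar_prod_add_distrib[of _ n])

text \<open>The difference \<open>B\<close> of the two sides is sesquilinear and vanishes on the
  diagonal. Expanding at \<open>x + c y\<close> with \<open>c = 1\<close> and
  \<open>c = \<i>\<close> gives \<open>B x y = - B y x\<close> and
  \<open>B x y = B y x\<close>.\<close>

lemma frame_identity_polarize:
  fixes f :: "nat \<Rightarrow> complex vec" and A :: real
  assumes f: "\<And>j. j < m \<Longrightarrow> f j \<in> carrier_vec n"
    and frame: "\<And>x. x \<in> carrier_vec n \<Longrightarrow> (\<Sum>j<m. (cmod (x \<bullet>c f j))\<^sup>2) = A * Re (x \<bullet>c x)"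
    and xy: "x \<in> carrier_vec n" "y \<in> carrier_vec n"
  shows "(\<Sum>j<m. (x \<bullet>c f j) * (f j \<bullet>c y)) = A * (x \<bullet>c y)"
proof -
  define B where "B x y = (\<Sum>j<m. (x \<bullet>c f j) * (f j \<bullet>c y)) - A * (x \<bullet>c y)" for x y
  have B0: "B x x = 0" if x: "x \<in> carrier_vec n" for x
  proof -
    have "(\<Sum>j<m. (x \<bullet>c f j) * (f j \<bullet>c x)) = (\<Sum>j<m. of_real ((cmod (x \<bullet>c f j))\<^sup>2))"
      using f x
      by (intro sum.cong) (auto simp: complex_norm_square cscalar_prod_commute[of _ n] simp del: of_real_power)
    also have "\<dots> = of_real (A * Re (x \<bullet>c x))"
      using frame[OF x] by (simp only: of_real_sum[symmetric])
    also have "\<dots> = A * (x \<bullet>c x)"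
      using cscalar_prod_commute[OF x x] by (simp add: complex_eq_iff)
    finally show ?thesis by (simp add: B_def)
  qed
  have "cnj c * B x y + c * B y x = 0" for c
  proof -
    have "B (x + c \<cdot>\<^sub>v y) (x + c \<cdot>\<^sub>v y) = B x x + cnj c * B x y + c * B y x + c * cnj c * B y y"
      using xy f unfolding B_def
      by (simp add: cscalar_prod_lincomb_left[of _ n] cscalar_prod_lincomb_right[of _ n]
          algebra_simps sum.distrib sum_distrib_left)
    then show ?thesis using B0 xy by simp
  qed
  from this[of 1] this[of \<i>] have "B x y = 0" by (simp add: algebra_simps)
  then show ?thesis by (simp add: B_def)
qed

text \<open>Summing over the standard basis computes the trace of the frame operator in two ways:
  \<open>n\<close> times the frame bound, and the sum of the squared norms of the \<open>m\<close>
  unit vectors.\<close>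

lemma frame_constant:
  fixes f :: "nat \<Rightarrow> complex vec" and A :: real
  assumes f: "\<And>j. j < m \<Longrightarrow> f j \<in> carrier_vec n" "\<And>j. j < m \<Longrightarrow> f j \<bullet>c f j = 1"
    and frame: "\<And>x. x \<in> carrier_vec n \<Longrightarrow> (\<Sum>j<m. (cmod (x \<bullet>c f j))\<^sup>2) = A * Re (x \<bullet>c x)"
  shows "A * n = m"
proof -
  have "A * n = (\<Sum>i<n. A * Re (unit_vec n i \<bullet>c unit_vec n i))"
    by (simp add: scalar_prod_def unit_vec_def if_distrib cong: if_cong)
  also have "\<dots> = (\<Sum>i<n. \<Sum>j<m. (cmod (unit_vec n i \<bullet>c f j))\<^sup>2)" using frame by simp
  also have "\<dots> = (\<Sum>i<n. \<Sum>j<m. (cmod (f j $ i))\<^sup>2)" proof (intro sum.cong refl)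
    fix i j assume "i \<in> {..<n}" "j \<in> {..<m}"
    then have "i < n" "f j \<in> carrier_vec n" using f by auto
    then show "(cmod (unit_vec n i \<bullet>c f j))\<^sup>2 = (cmod (f j $ i))\<^sup>2" by simp
  qed
  also have "\<dots> = (\<Sum>j<m. \<Sum>i<n. (cmod (f j $ i))\<^sup>2)" by (rule sum.swap)
  also have "\<dots> = (\<Sum>j<m. 1)"
  proof (rule sum.cong[OF refl])
    fix j assume "j \<in> {..<m}"
    then have j: "f j \<in> carrier_vec n" "f j \<bullet>c f j = 1" using f by auto
    have "of_real (\<Sum>i<n. (cmod (f j $ i))\<^sup>2) = f j \<bullet>c f j"
      using j(1) by (simp add: scalar_prod_def lessThan_atLeast0 complex_norm_square del: of_real_power)
    then show "(\<Sum>i<n. (cmod (f j $ i))\<^sup>2) = 1" using j(2) by (metis of_real_eq_1_iff)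
  qed
  finally show ?thesis by simp
qed

text \<open>Both sides are sesquilinear expressions, so it suffices to compare them on a basis, and
  the first \<open>n\<close> frame vectors form one. The hypothesis is then a relation between Gram
  entries only.\<close>

lemma frame_identity_extend:
  fixes f :: "nat \<Rightarrow> complex vec"
  assumes f: "\<And>j. j < m \<Longrightarrow> f j \<in> carrier_vec n" and "n \<le> m" "lin_indep_family n f"
    and gram: "\<And>k l. k < n \<Longrightarrow> l < n \<Longrightarrow> (\<Sum>j<m. (f k \<bullet>c f j) * (f j \<bullet>c f l)) = A * (f k \<bullet>c f l)"
    and x: "x \<in> carrier_vec n"
  shows "(\<Sum>j<m. (x \<bullet>c f j) * (f j \<bullet>c x)) = A * (x \<bullet>c x)"
proof -
  have fn: "f k \<in> carrier_vec n" if "k < n" for k using f that \<open>n \<le> m\<close> by simp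
  obtain c where c: "x = vec n (\<lambda>i. \<Sum>k<n. c k * f k $ i)"
    using lin_indep_family_spans[OF assms(3) x] .
  have left: "x \<bullet>c y = (\<Sum>k<n. c k * (f k \<bullet>c y))" if "y \<in> carrier_vec n" for y
    unfolding c using that fn by (rule sum_vec_cscalar_left)
  have right: "y \<bullet>c x = (\<Sum>k<n. cnj (c k) * (y \<bullet>c f k))" if "y \<in> carrier_vec n" for y
    unfolding c using that fn by (rule sum_vec_cscalar_right)
  have "(\<Sum>j<m. (x \<bullet>c f j) * (f j \<bullet>c x))
      = (\<Sum>j<m. \<Sum>k<n. \<Sum>l<n. c k * cnj (c l) * ((f k \<bullet>c f j) * (f j \<bullet>c f l)))"
    using f by (intro sum.cong[OF refl]) (simp add: left right sum_product mult_ac)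
  also have "\<dots> = (\<Sum>k<n. \<Sum>l<n. \<Sum>j<m. c k * cnj (c l) * ((f k \<bullet>c f j) * (f j \<bullet>c f l)))"
    by (subst sum.swap, intro sum.cong[OF refl]) (rule sum.swap)
  also have "\<dots> = (\<Sum>k<n. \<Sum>l<n. c k * cnj (c l) * (A * (f k \<bullet>c f l)))"
    using gram by (intro sum.cong[OF refl]) (simp flip: sum_distrib_left)
  also have "\<dots> = A * (x \<bullet>c x)"
    using fn by (simp add: left[OF x] right sum_distrib_left mult_ac)
  finally show ?thesis .
qed

section \<open>Sums of periodic functions over one period\<close>

lemma periodic_mod:
  fixes f :: "int \<Rightarrow> 'a"
  assumes "\<And>k. f (k + int n) = f k"
  shows "f (k mod int n) = f k"
proof -
  have *: "f (j + int n * int m) = f j" for j and m :: nat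
  proof (induction m)
    case (Suc m)
    then show ?case using assms[of "j + int n * int m"] by (simp add: algebra_simps)
  qed simp
  show ?thesis
  proof (cases "k div int n \<ge> 0")
    case True
    then show ?thesis using *[of "k mod int n" "nat (k div int n)"] by simp
  next
    case False
    then have "k mod int n = k + int n * int (nat (- (k div int n)))"
      by (simp add: minus_div_mult_eq_mod[symmetric] mult.commute)
    then show ?thesis using * by metis
  qed
qed

text \<open>Modulo \<open>n\<close> the reflection \<open>k \<mapsto> l - k\<close> is its own
  inverse, so one map serves as both reindexing witnesses.\<close>

lemma sum_periodic_reflect:
  fixes f :: "int \<Rightarrow> 'a :: comm_monoid_add"
  assumes "\<And>k. f (k + int n) = f k" "n \<ge> 1"
  shows "(\<Sum>k<n. f (l - int k)) = (\<Sum>k<n. f (int k))"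
proof (rule sum.reindex_bij_witness
    [where i = "\<lambda>k. nat ((l - int k) mod int n)" and j = "\<lambda>k. nat ((l - int k) mod int n)"])
  fix k assume k: "k \<in> {..<n}"
  have m: "int (nat ((l - int k) mod int n)) = (l - int k) mod int n" using assms(2) by simp
  show "nat ((l - int (nat ((l - int k) mod int n))) mod int n) = k"
    unfolding m using k by (simp add: mod_simps)
  show "nat ((l - int k) mod int n) \<in> {..<n}" using assms(2) by (simp add: nat_less_iff)
  show "f (int (nat ((l - int k) mod int n))) = f (l - int k)"
    unfolding m by (rule periodic_mod[of f, OF assms(1)])
next
  fix k assume k: "k \<in> {..<n}"
  have m: "int (nat ((l - int k) mod int n)) = (l - int k) mod int n" using assms(2) by simp
  show "nat ((l - int (nat ((l - int k) mod int n))) mod int n) = k"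
    unfolding m using k by (simp add: mod_simps)
  show "nat ((l - int k) mod int n) \<in> {..<n}" using assms(2) by (simp add: nat_less_iff)
qed

context dihedral_orbit
begin

text \<open>The vanishing convolution says that the combination of the \<open>w (- k)\<close> with
  coefficients \<open>c k\<close> is orthogonal to every \<open>u l\<close>, hence zero. The
  \<open>w (- k)\<close> have the same Gram matrix as the \<open>u k\<close>, so they are
  independent too and \<open>c\<close> vanishes.\<close>

lemma real_part_zero:
  assumes frame: "\<And>x y. x \<in> carrier_vec n \<Longrightarrow> y \<in> carrier_vec n \<Longrightarrow>
      (\<Sum>k<n. (x \<bullet>c u (int k)) * (u (int k) \<bullet>c y)) + (\<Sum>k<n. (x \<bullet>c w (int k)) * (w (int k) \<bullet>c y))
      = 2 * (x \<bullet>c y)"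
    and indep: "lin_indep_family n (\<lambda>k. u (int k))"
    and j: "0 < j" "j < n"
  shows "a (int j) + a (- int j) = 0"
proof -
  define c where "c k = a (int k) + a (- int k) - (if k = 0 then 2 else 0)" for k
  have conv: "(\<Sum>k<n. c k * b (l - int k)) = 0" for l
  proof -
    \<comment> \<open>The frame identity for the mixed pair \<open>w l\<close>, \<open>u 0\<close>:
      each of the two orbits contributes one sum of products of an \<open>a\<close> and a
      \<open>b\<close>.\<close>
    have "(\<Sum>k<n. b (l - int k) * a (int k)) + (\<Sum>k<n. a (int k - l) * b (int k)) = 2 * b l"
      using frame[OF w_carrier[of l] u_carrier[of 0]] by (simp add: wu uu ww)
    moreover have "(\<Sum>k<n. a (int k - l) * b (int k)) = (\<Sum>k<n. a (l - int k - l) * b (l - int k))"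
    \<comment> \<open>Each factor is periodic only up to \<open>z\<close>; the product acquires
      \<open>z\<^sup>2 = 1\<close>.\<close>
    proof (rule sum_periodic_reflect[symmetric, OF _ n])
      fix k
      have "a (k + int n - l) = z * a (k - l)" using a_period[of "k - l"] by (simp add: algebra_simps)
      then show "a (k + int n - l) * b (k + int n) = a (k - l) * b k"
        using z by (simp add: b_period power2_eq_square)
    qed
    moreover have "(\<Sum>k<n. (if k = 0 then 2 else 0) * b (l - int k)) = 2 * b l"
      using n by (simp add: if_distrib[of "\<lambda>x. x * _"] cong: if_cong)
    moreover have "(\<Sum>k<n. c k * b (l - int k)) = (\<Sum>k<n. b (l - int k) * a (int k))
        + (\<Sum>k<n. a (l - int k - l) * b (l - int k)) - (\<Sum>k<n. (if k = 0 then 2 else 0) * b (l - int k))"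
      unfolding c_def by (simp add: algebra_simps sum.distrib sum_subtractf)
    ultimately show ?thesis by simp
  qed
  let ?y = "vec n (\<lambda>i. \<Sum>k<n. c k * w (- int k) $ i)"
  have y: "?y \<in> carrier_vec n" by simp
  have y_left: "?y \<bullet>c x = (\<Sum>k<n. c k * (w (- int k) \<bullet>c x))" if "x \<in> carrier_vec n" for x
    using that w_carrier by (intro sum_vec_cscalar_left) auto
  have "?y \<bullet>c u (int l) = 0" for l :: nat
    using conv[of "- int l"] u_carrier by (simp add: y_left wu minus_diff_commute)
  then have "?y = 0\<^sub>v n"
    using lin_indep_family_orthogonal[OF indep _ y] u_carrier by blast
  \<comment> \<open>Pairing with \<open>w (- l)\<close> produces the coefficients
    \<open>a (k - l)\<close>, which are the Gram entries of the \<open>u k\<close>.\<close>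
  then have "?y \<bullet>c w (- int l) = 0" for l :: nat
    using w_carrier[of "- int l"] by simp
  then have "(\<Sum>k<n. c k * (u (int k) \<bullet>c u (int l))) = 0" for l :: nat
    using y_left[OF w_carrier] by (simp add: ww uu)
  then have "c j = 0"
    using indep j u_carrier by (subst (asm) lin_indep_family_iff_gram) auto
  then show ?thesis using j by (simp add: c_def)
qed

end

text \<open>There are \<open>n\<close> distinct roots of \<open>x ^ n = z\<close>, too many for a
  nonzero polynomial of degree below \<open>n\<close>.\<close>

lemma poly_nonroot_exists:
  fixes c :: "nat \<Rightarrow> complex"
  assumes "k < n" "c k \<noteq> 0" "z \<noteq> 0"
  shows "\<exists>x. x ^ n = z \<and> (\<Sum>k<n. c k * x ^ k) \<noteq> 0"
proof (rule ccontr)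
  assume no: "\<not> ?thesis"
  define p where "p = (\<Sum>k<n. Polynomial.monom (c k) k)"
  have coeff: "Polynomial.coeff p i = (if i < n then c i else 0)" for i
    by (simp add: p_def coeff_sum if_distrib cong: if_cong)
  have p0: "p \<noteq> 0" using coeff[of k] assms by auto
  have "poly p x = (\<Sum>k<n. c k * x ^ k)" for x by (simp add: p_def poly_sum poly_monom)
  then have "{x. x ^ n = z} \<subseteq> {x. poly p x = 0}" using no by auto
  then have "card {x. x ^ n = z} \<le> card {x. poly p x = 0}"
    using p0 by (intro card_mono poly_roots_finite)
  also have "\<dots> \<le> Polynomial.degree p" using p0 by (rule card_poly_roots_bound)
  also have "\<dots> < n" using assms(1) by (intro degree_lessI) (auto simp: coeff p0)
  also have "n = card {x. x ^ n = z}" using assms by (simp add: card_nth_roots)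
  finally show False by simp
qed

text \<open>The Gram matrix of the \<open>u k\<close> is circulant up to the twist \<open>z\<close>,
  so its singularity means a zero Fourier coefficient at a root of \<open>x ^ n = z\<close>. The
  values \<open>e\<close> stand for whatever phases an unknown switching contributes, and
  \<open>S\<close> for signs in an unknown order.\<close>

lemma (in dihedral_orbit) lin_indep_of_skew_phases:
  assumes even: "even n" and r: "r = 1 / sqrt (2 * real n - 1)"
    and e: "\<And>k. k < n \<Longrightarrow> cmod (e k) = 1"
    and S: "\<And>k l. k < n \<Longrightarrow> l < n \<Longrightarrow> S k l \<in> {1, -1 :: complex}"
    and gram: "\<And>k l. k < n \<Longrightarrow> l < n \<Longrightarrow> k \<noteq> l \<Longrightarrow>
      a (int l - int k) = \<i> * of_real r * e k * cnj (e l) * S k l"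
  shows "lin_indep_family n (\<lambda>k. u (int k))"
proof (rule ccontr)
  assume "\<not> ?thesis"
  then obtain c k0 where c: "\<And>l. l < n \<Longrightarrow> (\<Sum>k<n. c k * a (int k - int l)) = 0"
    and k0: "k0 < n" "c k0 \<noteq> 0"
    by (subst (asm) lin_indep_family_iff_gram) (use u_carrier uu in auto)
  have z0: "z \<noteq> 0" using z by auto
  \<comment> \<open>The roots of \<open>x ^ n = z\<close> are the characters fitting the twisted
    period. The kernel vector \<open>c\<close> has a nonzero transform at one of them.\<close>
  obtain x where x: "x ^ n = z" "(\<Sum>k<n. c k * x ^ k) \<noteq> 0"
    using poly_nonroot_exists[of k0 n c z] k0 z0 by blast
  have x0: "x \<noteq> 0" using x(1) z0 n by (intro notI) (simp add: power_0_left)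
  have n2: "n \<ge> 2" using n even by presburger
  have r0: "r > 0" using n by (simp add: r)
  have r2: "r\<^sup>2 * real (2 * n - 1) = 1"
    using n by (simp add: r power_divide of_nat_diff)
  have ecnj: "cnj (e k) * e k = 1" if "k < n" for k
    using e[OF that] by (simp add: mult.commute complex_norm_square[symmetric])
  define B where "B = (\<Sum>j<n. inverse x ^ j * a (int j))"
  have "B = 0"
  proof -
    \<comment> \<open>The factor \<open>x powi (- m)\<close> compensates the twist, so
      \<open>g\<close> is periodic.\<close>
    define g where "g m = x powi (- m) * a m" for m
    have per: "g (m + int n) = g m" for m
    proof -
      have "x powi (- (m + int n)) = x powi (- m) * inverse z"
        using x0 x(1) by (simp add: power_int_diff power_int_minus divide_inverse)
      then show ?thesis using z0 by (simp add: g_def a_period)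
    qed
    \<comment> \<open>Convolution theorem: the transform of \<open>c\<close> times \<open>B\<close>
      is the transform of a zero vector.\<close>
    have "(\<Sum>k<n. c k * x ^ k) * B = (\<Sum>k<n. c k * x ^ k * (\<Sum>j<n. g (int k - int j)))"
      unfolding sum_periodic_reflect[of g, OF per n]
      by (simp add: B_def g_def power_int_minus sum_distrib_right power_inverse)
    also have "\<dots> = (\<Sum>k<n. \<Sum>j<n. x ^ j * (c k * a (int k - int j)))"
      unfolding sum_distrib_left
    proof (intro sum.cong refl)
      fix k j
      have "x ^ k * x powi (- (int k - int j)) = x ^ j"
        using x0 by (simp add: power_int_diff)
      then show "c k * x ^ k * g (int k - int j) = x ^ j * (c k * a (int k - int j))"
        by (simp add: g_def mult_ac)
    qed
    also have "\<dots> = (\<Sum>j<n. x ^ j * (\<Sum>k<n. c k * a (int k - int j)))"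
      unfolding sum_distrib_left by (rule sum.swap)
    also have "\<dots> = 0" using c by simp
    finally show ?thesis using x(2) by simp
  qed
  \<comment> \<open>All neighbouring pairs have the same Gram entry \<open>a 1\<close>, so every
    \<open>e k * cnj (e (Suc k))\<close> equals \<open>\<omega>\<close> up to sign, and products of
    these telescope.\<close>
  define \<omega> where "\<omega> = e 0 * cnj (e 1)"
  have step: "\<exists>s \<in> {1, -1 :: int}. e k * cnj (e (Suc k)) = of_int s * \<omega>" if k: "Suc k < n" for k
  proof -
    have "a 1 = \<i> * of_real r * e k * cnj (e (Suc k)) * S k (Suc k)" using gram[of k "Suc k"] k by simp
    moreover have "a 1 = \<i> * of_real r * e 0 * cnj (e 1) * S 0 1" using gram[of 0 1] n2 by simp
    ultimately have "e k * cnj (e (Suc k)) * S k (Suc k) = \<omega> * S 0 1"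
      using r0 by (simp add: \<omega>_def mult.assoc)
    moreover have "S k (Suc k) \<in> {1, -1}" "S 0 1 \<in> {1, -1}" using S k n2 by auto
    ultimately show ?thesis by (auto simp: minus_equation_iff[of _ \<omega>])
  qed
  have pow: "\<exists>s \<in> {1, -1 :: int}. e 0 * cnj (e j) = of_int s * \<omega> ^ j" if "j < n" for j
    using that
  proof (induction j)
    case 0
    then show ?case using ecnj[of 0] by (intro bexI[of _ 1]) (auto simp: mult.commute)
  next
    case (Suc j)
    have "\<exists>s \<in> {1, -1 :: int}. e 0 * cnj (e j) = of_int s * \<omega> ^ j" using Suc by simp
    then obtain s :: int where s: "s \<in> {1, -1}" "e 0 * cnj (e j) = of_int s * \<omega> ^ j" by blast
    obtain t :: int where t: "t \<in> {1, -1}" "e j * cnj (e (Suc j)) = of_int t * \<omega>"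
      using step[OF Suc.prems] by blast
    have "e 0 * cnj (e (Suc j)) = (e 0 * cnj (e j)) * (e j * cnj (e (Suc j)))"
      using ecnj[of j] Suc.prems by (simp add: algebra_simps)
    also have "\<dots> = of_int (s * t) * \<omega> ^ Suc j" by (simp add: s(2) t(2))
    finally show ?case using s(1) t(1) by (intro bexI[of _ "s * t"]) auto
  qed
  have "\<exists>s \<in> {1, -1 :: int}. a (int j) = \<i> * of_real r * of_int s * \<omega> ^ j" if j: "0 < j" "j < n" for j
  proof -
    obtain s where s: "s \<in> {1, -1 :: int}" "e 0 * cnj (e j) = of_int s * \<omega> ^ j" using pow[OF j(2)] by blast
    obtain t :: int where t: "t \<in> {1, -1}" "S 0 j = of_int t"
    proof (cases "S 0 j = 1")
      case True
      then show ?thesis using that[of 1] by simp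
    next
      case False
      then show ?thesis using that[of "-1"] S[of 0 j] j by simp
    qed
    have "a (int j) = \<i> * of_real r * (e 0 * cnj (e j)) * S 0 j" using gram[of 0 j] j by simp
    also have "\<dots> = \<i> * of_real r * of_int (s * t) * \<omega> ^ j" by (simp add: s(2) t(2))
    finally show ?thesis using s(1) t(1) by (intro bexI[of _ "s * t"]) auto
  qed
  then obtain s :: "nat \<Rightarrow> int" where s: "\<And>j. 0 < j \<Longrightarrow> j < n \<Longrightarrow> s j \<in> {1, -1}"
    and a: "\<And>j. 0 < j \<Longrightarrow> j < n \<Longrightarrow> a (int j) = \<i> * of_real r * of_int (s j) * \<omega> ^ j"
    by metis
  have \<omega>1: "\<omega> * cnj \<omega> = 1"
    using ecnj[of 0] ecnj[of 1] n2 by (simp add: \<omega>_def algebra_simps)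
  have "(\<omega> ^ n)\<^sup>2 = 1"
  proof -
    \<comment> \<open>Differences \<open>n - 1\<close> and \<open>-1\<close> agree up to the twist.
      This closes the chain of neighbours into a cycle and determines \<open>\<omega> ^ n\<close> up
      to sign.\<close>
    have "a (int (n - 1)) = z * cnj (a 1)"
      using a_period[of "-1"] a_cnj[of 1] n by (simp add: of_nat_diff algebra_simps)
    then have "(\<i> * of_real r) * (of_int (s (n - 1)) * \<omega> ^ (n - 1))
        = (\<i> * of_real r) * (- z * of_int (s 1) * cnj \<omega>)"
      using a[of 1] a[of "n - 1"] n2 by (simp add: mult_ac)
    then have "of_int (s (n - 1)) * \<omega> ^ (n - 1) = - z * of_int (s 1) * cnj \<omega>"
      using r0 by (subst (asm) mult_cancel_left) simp
    then have "of_int (s (n - 1)) * \<omega> ^ (n - 1) * \<omega> = - z * of_int (s 1) * (\<omega> * cnj \<omega>)"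
      by (simp add: mult_ac)
    moreover have "\<omega> ^ n = \<omega> ^ (n - 1) * \<omega>" using n by (cases n) auto
    ultimately have "of_int (s (n - 1)) * \<omega> ^ n = - z * of_int (s 1)" using \<omega>1 by (simp add: mult.assoc)
    then have "(of_int (s (n - 1)) * \<omega> ^ n)\<^sup>2 = (- z * of_int (s 1))\<^sup>2" by simp
    moreover have "s (n - 1) \<in> {1, -1}" "s 1 \<in> {1, -1}" using s n2 by auto
    ultimately show ?thesis using z by (auto simp: power_mult_distrib)
  qed
  \<comment> \<open>The phase \<open>\<omega>\<close> and the character \<open>x\<close> enter
    \<open>B\<close> only through this quotient.\<close>
  define \<zeta> where "\<zeta> = \<omega> * inverse x"
  have "\<zeta> ^ (2 * n) = (\<omega> ^ n)\<^sup>2 * inverse ((x ^ n)\<^sup>2)"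
    by (simp add: \<zeta>_def power_mult_distrib power_inverse mult.commute[of 2] power_mult)
  then have \<zeta>: "\<zeta> ^ (2 * n) = 1" using \<open>(\<omega> ^ n)\<^sup>2 = 1\<close> x(1) z by simp
  define \<beta> where "\<beta> = (\<Sum>j\<in>{1..<n}. of_int (s j) * \<zeta> ^ j)"
  \<comment> \<open>The term for \<open>j = 0\<close> is \<open>a 0 = 1\<close>; the rest carries
    the common factor \<open>\<i> r\<close>.\<close>
  have "B = 1 + (\<Sum>j\<in>{1..<n}. inverse x ^ j * a (int j))"
    using n a_0 by (simp add: B_def lessThan_atLeast0 sum.atLeast_Suc_lessThan)
  also have "(\<Sum>j\<in>{1..<n}. inverse x ^ j * a (int j)) = \<i> * of_real r * \<beta>"
    unfolding \<beta>_def sum_distrib_left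
    by (intro sum.cong) (auto simp: a \<zeta>_def power_mult_distrib)
  finally have "\<i> * of_real r * \<beta> = - 1" using \<open>B = 0\<close> by (simp add: eq_neg_iff_add_eq_0 add.commute)
  then have "(\<i> * of_real r * \<beta>)\<^sup>2 = 1" by simp
  then have "- (of_real (r\<^sup>2) * \<beta>\<^sup>2) = 1" by (simp add: power_mult_distrib)
  then have "of_real (r\<^sup>2) * \<beta>\<^sup>2 = - 1" by (metis minus_minus)
  moreover have "of_real (r\<^sup>2 * real (2 * n - 1)) * \<beta>\<^sup>2 = of_nat (2 * n - 1) * (of_real (r\<^sup>2) * \<beta>\<^sup>2)"
    by (simp only: of_real_mult of_real_of_nat_eq mult_ac)
  ultimately have "of_real (r\<^sup>2 * real (2 * n - 1)) * \<beta>\<^sup>2 = - of_nat (2 * n - 1)" by simp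
  then have "\<beta>\<^sup>2 = - of_nat (2 * n - 1)" unfolding r2 by simp
  moreover have "\<beta> \<in> int_span_powers \<zeta>"
    unfolding \<beta>_def by (intro int_span_powers_sum int_span_powers.monom)
  moreover have "(2 * n - 1) mod 4 = 3"
  proof -
    obtain m where "n = 2 * Suc m" using even n by (metis dvd_def not0_implies_Suc mult_0_right not_one_le_zero)
    then have "2 * n - 1 = 3 + 4 * m" by simp
    then show ?thesis by simp
  qed
  moreover have "coprime (2 * n - 1) (2 * n)" using n by (intro coprime_diff_one_left_nat) simp
  moreover have "2 * n > 0" using n by simp
  ultimately show False
    using neg_sqrt_3_mod_4_notin_int_span_powers[of "2 * n - 1" "2 * n" \<zeta> \<beta>] \<zeta> n by blast
qed

section \<open>Skew Hadamard matrices\<close>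

text \<open>Diagonal of the matrix conjugating the target into skew form: in a mixed block the
  phases multiply with the leading \<i> to 1 or -1, so the symmetric pair \<open>Q\<close>,
  \<open>Q\<^sup>T\<close> becomes the skew pair \<open>Q\<close>,
  \<open>- Q\<^sup>T\<close>.\<close>

definition block_phase :: "nat \<Rightarrow> nat \<Rightarrow> complex" where
  "block_phase n k = (if k < n then 1 else \<i>)"

lemma cmod_block_phase: "cmod (block_phase n k) = 1"
  by (simp add: block_phase_def)

lemma target_gram_index:
  assumes "P \<in> carrier_mat n n" "Q \<in> carrier_mat n n" "k < 2 * n" "l < 2 * n"
  shows "target_gram n P Q $$ (k, l) = (if k = l then 1 else 0) +
    \<i> * of_real (1 / sqrt (2 * real n - 1)) * block_phase n k * cnj (block_phase n l) *
    of_real (skew_block P Q $$ (k, l) - (if k = l then 1 else 0))"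
  using assms
  by (cases "k < n"; cases "l < n") (auto simp: target_gram_def skew_block_def block_phase_def)

lemma target_gram_carrier:
  "P \<in> carrier_mat n n \<Longrightarrow> Q \<in> carrier_mat n n \<Longrightarrow> target_gram n P Q \<in> carrier_mat (2 * n) (2 * n)"
  by (rule carrier_matI) (simp_all add: target_gram_def)

lemma skew_block_index:
  assumes "P \<in> carrier_mat n n" "Q \<in> carrier_mat n n" "k < 2 * n" "l < 2 * n"
  shows "skew_block P Q $$ (k, l) =
    (if k < n then if l < n then P $$ (k, l) else Q $$ (k, l - n)
     else if l < n then - Q $$ (l, k - n) else P $$ (l - n, k - n))"
  using assms by (auto simp: skew_block_def)

lemma skew_hadamard_iff:
  "skew_hadamard m H \<longleftrightarrow> H \<in> carrier_mat m m \<and>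
     (\<forall>k<m. \<forall>l<m. H $$ (k, l) \<in> {1, -1}) \<and>
     (\<forall>k<m. \<forall>l<m. (\<Sum>j<m. H $$ (k, j) * H $$ (l, j)) = (if k = l then real m else 0)) \<and>
     (\<forall>k<m. \<forall>l<m. H $$ (k, l) + H $$ (l, k) = (if k = l then 2 else 0))"
proof (cases "H \<in> carrier_mat m m")
  case True
  have "H * transpose_mat H = real m \<cdot>\<^sub>m 1\<^sub>m m \<longleftrightarrow>
      (\<forall>k<m. \<forall>l<m. (\<Sum>j<m. H $$ (k, j) * H $$ (l, j)) = (if k = l then real m else 0))"
    using True by (auto simp: mat_eq_iff scalar_prod_def lessThan_atLeast0)
  moreover have "H + transpose_mat H = 2 \<cdot>\<^sub>m 1\<^sub>m m \<longleftrightarrow>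
      (\<forall>k<m. \<forall>l<m. H $$ (k, l) + H $$ (l, k) = (if k = l then 2 else 0))"
    using True by (auto simp: mat_eq_iff)
  ultimately show ?thesis using True by (simp add: skew_hadamard_def)
qed (simp add: skew_hadamard_def)

text \<open>Compare three distinct rows: every term of the sum of \<open>(h\<^sub>0 + h\<^sub>1)(h\<^sub>0 + h\<^sub>2)\<close> over the columns
  is 0 or 4, and by orthogonality the sum is the order.\<close>

lemma hadamard_order_dvd:
  fixes H :: "nat \<Rightarrow> nat \<Rightarrow> real"
  assumes "m \<ge> 3" and H: "\<And>k l. k < m \<Longrightarrow> l < m \<Longrightarrow> H k l \<in> {1, -1}"
    and orth: "\<And>k l. k < m \<Longrightarrow> l < m \<Longrightarrow> (\<Sum>j<m. H k j * H l j) = (if k = l then real m else 0)"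
  shows "4 dvd m"
proof -
  let ?A = "{j \<in> {..<m}. H 0 j = H 1 j \<and> H 0 j = H 2 j}"
  have "(\<Sum>j<m. (H 0 j + H 1 j) * (H 0 j + H 2 j)) = real m"
    using assms(1) orth[of 0 0] orth[of 0 1] orth[of 0 2] orth[of 1 2]
    by (simp add: algebra_simps sum.distrib)
  moreover have "(\<Sum>j<m. (H 0 j + H 1 j) * (H 0 j + H 2 j)) = (\<Sum>j<m. if j \<in> ?A then 4 else 0)"
  proof (rule sum.cong[OF refl])
    fix j assume "j \<in> {..<m}"
    then have "H 0 j = 1 \<or> H 0 j = -1" "H 1 j = 1 \<or> H 1 j = -1" "H 2 j = 1 \<or> H 2 j = -1" "j < m"
      using H[of _ j] assms(1) by auto
    then show "(H 0 j + H 1 j) * (H 0 j + H 2 j) = (if j \<in> ?A then 4 else 0)"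
      by (elim disjE) simp_all
  qed
  moreover have "(\<Sum>j<m. if j \<in> ?A then 4 else 0 :: real) = real (4 * card ?A)"
    by (simp add: sum.If_cases Int_def)
  ultimately have "m = 4 * card ?A" by linarith
  then show ?thesis by (metis dvd_triv_left)
qed

text \<open>Write \<open>T = 1 + K\<close>, where \<open>K\<close> is \<open>\<i> r S\<close>
  conjugated by the phases and \<open>S = H - 1\<close> is skew. Then \<open>T\<^sup>2 = 2 T\<close>
  amounts to \<open>K\<^sup>2 = 1\<close>, that is \<open>r\<^sup>2 S S\<^sup>T = 1\<close>.
  Skewness also gives \<open>H H\<^sup>T = S S\<^sup>T + 1\<close>, so the value of \<open>r\<close>
  turns this into \<open>H H\<^sup>T = m\<close>. All of it holds entry by entry.\<close>

lemma skew_gram_square_iff: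
  fixes H :: "nat \<Rightarrow> nat \<Rightarrow> real" and e :: "nat \<Rightarrow> complex" and r :: real
  assumes e: "\<And>k. k < m \<Longrightarrow> cmod (e k) = 1" and r: "r\<^sup>2 * (real m - 1) = 1"
    and skew: "\<And>k l. k < m \<Longrightarrow> l < m \<Longrightarrow> H k l + H l k = (if k = l then 2 else 0)"
    and T: "\<And>k l. k < m \<Longrightarrow> l < m \<Longrightarrow> T k l = (if k = l then 1 else 0) +
      \<i> * of_real r * e k * cnj (e l) * of_real (H k l - (if k = l then 1 else 0))"
    and kl: "k < m" "l < m"
  shows "(\<Sum>j<m. T k j * T j l) = 2 * T k l \<longleftrightarrow> (\<Sum>j<m. H k j * H l j) = (if k = l then real m else 0)"
proof -
  define S where "S k l = H k l - (if k = l then 1 else 0)" for k l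
  let ?K = "\<lambda>k l. \<i> * of_real r * e k * cnj (e l) * of_real (S k l)"
  have T': "T k l = (if k = l then 1 else 0) + ?K k l" if "k < m" "l < m" for k l
    using T[OF that] by (simp add: S_def)
  have ee: "e k * cnj (e k) = 1" if "k < m" for k
    using e[OF that] by (simp add: complex_norm_square[symmetric])
  have S: "S k l = - S l k" if "k < m" "l < m" for k l
    using skew[OF that] by (auto simp: S_def split: if_splits)
  have r0: "r \<noteq> 0" using r by auto
  have "(\<Sum>j<m. T k j * T j l) = (\<Sum>j<m. (if k = j then if j = l then 1 else 0 else 0)
      + (if k = j then ?K j l else 0) + (if j = l then ?K k j else 0) + ?K k j * ?K j l)"
    using kl by (intro sum.cong[OF refl]) (simp add: T' algebra_simps)
  also have "\<dots> = (if k = l then 1 else 0) + ?K k l + ?K k l + (\<Sum>j<m. ?K k j * ?K j l)"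
    using kl by (simp add: sum.distrib)
  also have "(\<Sum>j<m. ?K k j * ?K j l)
      = (\<Sum>j<m. of_real (r\<^sup>2) * (e k * cnj (e l)) * of_real (S k j * S l j))"
  proof (rule sum.cong[OF refl])
    fix j assume "j \<in> {..<m}"
    then have j: "j < m" by simp
    have "?K k j * ?K j l = \<i> * \<i> * of_real (r\<^sup>2) * (e k * cnj (e l)) * (e j * cnj (e j)) * of_real (S k j * S j l)"
      by (simp add: power2_eq_square mult_ac)
    also have "\<dots> = of_real (r\<^sup>2) * (e k * cnj (e l)) * of_real (S k j * S l j)"
      unfolding ee[OF j] S[OF j kl(2)] by simp
    finally show "?K k j * ?K j l = \<dots>" .
  qed
  also have "\<dots> = of_real (r\<^sup>2) * (e k * cnj (e l)) * of_real (\<Sum>j<m. S k j * S l j)"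
    by (simp add: sum_distrib_left)
  finally have TT: "(\<Sum>j<m. T k j * T j l) = 2 * T k l \<longleftrightarrow>
      of_real (r\<^sup>2) * (e k * cnj (e l)) * of_real (\<Sum>j<m. S k j * S l j) = (if k = l then 1 else 0 :: complex)"
    using T'[OF kl] by auto
  have "(\<Sum>j<m. H k j * H l j) = (\<Sum>j<m. S k j * S l j + (if k = j then S l j else 0)
      + (if l = j then S k j else 0) + (if k = j then if l = j then 1 else 0 else 0))"
    by (intro sum.cong[OF refl]) (simp add: S_def algebra_simps)
  also have "\<dots> = (\<Sum>j<m. S k j * S l j) + S l k + S k l + (if k = l then 1 else 0)"
    using kl by (simp add: sum.distrib)
  finally have HH: "(\<Sum>j<m. H k j * H l j) = (\<Sum>j<m. S k j * S l j) + (if k = l then 1 else 0)"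
    using S[OF kl] by simp
  show ?thesis
  proof (cases "k = l")
    case True
    have "of_real (r\<^sup>2) * (e k * cnj (e l)) * of_real (\<Sum>j<m. S k j * S l j) = (1 :: complex)
        \<longleftrightarrow> r\<^sup>2 * (\<Sum>j<m. S k j * S l j) = 1"
      unfolding True
      by (simp only: ee[OF kl(2)] mult_1_right of_real_mult[symmetric] of_real_eq_1_iff)
    also have "\<dots> \<longleftrightarrow> r\<^sup>2 * (\<Sum>j<m. S k j * S l j) = r\<^sup>2 * (real m - 1)" using r by simp
    also have "\<dots> \<longleftrightarrow> (\<Sum>j<m. S k j * S l j) = real m - 1"
      using r0 by (simp only: mult_cancel_left) simp
    finally show ?thesis using TT HH True by auto
  next
    case False
    have "e k \<noteq> 0" "e l \<noteq> 0" using ee kl by force+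
    then have "of_real (r\<^sup>2) * (e k * cnj (e l)) * of_real (\<Sum>j<m. S k j * S l j) = (0 :: complex)
        \<longleftrightarrow> (\<Sum>j<m. S k j * S l j) = 0"
      using r0 by (simp only: mult_eq_0_iff of_real_eq_0_iff) simp
    then show ?thesis using TT HH False by auto
  qed
qed

lemma switching_equivalent_iff:
  assumes G: "G \<in> carrier_mat m m"
  shows "switching_equivalent m G G' \<longleftrightarrow> G' \<in> carrier_mat m m \<and>
    (\<exists>d \<sigma>. (\<forall>i<m. cmod (d i) = 1) \<and> \<sigma> permutes {..<m} \<and>
       (\<forall>k<m. \<forall>l<m. G' $$ (k, l) = d k * G $$ (\<sigma> k, \<sigma> l) * cnj (d l)))"
proof -
  have conj: "M * G * mat_adjoint M = mat m m (\<lambda>(k, l). d k * G $$ (\<sigma> k, \<sigma> l) * cnj (d l))"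
    if M: "M = mat_diag m d * mat m m (\<lambda>(i, j). if j = \<sigma> i then 1 else 0)" and \<sigma>: "\<sigma> permutes {..<m}"
    for M :: "complex mat" and d \<sigma>
  proof -
    have \<sigma>m: "\<sigma> i < m" if "i < m" for i using permutes_in_image[OF \<sigma>, of i] that by simp
    have Mi: "M = mat m m (\<lambda>(i, j). if j = \<sigma> i then d i else 0)"
      unfolding M by (subst mat_diag_mult_left[of _ m m]) (auto intro!: eq_matI)
    have MG: "(M * G) $$ (k, j) = d k * G $$ (\<sigma> k, j)" if "k < m" "j < m" for k j
    proof -
      have "(M * G) $$ (k, j) = (\<Sum>i<m. if i = \<sigma> k then d k * G $$ (i, j) else 0)"
        using G that by (simp add: Mi scalar_prod_def lessThan_atLeast0 if_distrib[of "\<lambda>x. x * _"] cong: if_cong)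
      then show ?thesis using \<sigma>m[OF that(1)] by simp
    qed
    show ?thesis
    proof (rule eq_matI)
      fix k l assume kl: "k < dim_row (mat m m (\<lambda>(k, l). d k * G $$ (\<sigma> k, \<sigma> l) * cnj (d l)))"
        "l < dim_col (mat m m (\<lambda>(k, l). d k * G $$ (\<sigma> k, \<sigma> l) * cnj (d l)))"
      then have kl: "k < m" "l < m" by auto
      have c: "M * G \<in> carrier_mat m m" using G by (auto simp: Mi)
      have "(M * G * mat_adjoint M) $$ (k, l) = (\<Sum>j<m. (M * G) $$ (k, j) * cnj (M $$ (l, j)))"
        using c kl
        by (simp add: mat_adjoint_alt scalar_prod_def lessThan_atLeast0 Mi) (auto intro!: sum.cong)
      also have "\<dots> = (\<Sum>j<m. if j = \<sigma> l then d k * G $$ (\<sigma> k, j) * cnj (d l) else 0)"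
        using kl by (intro sum.cong[OF refl]) (simp add: MG, simp add: Mi)
      also have "\<dots> = d k * G $$ (\<sigma> k, \<sigma> l) * cnj (d l)" using \<sigma>m[OF kl(2)] by simp
      finally show "(M * G * mat_adjoint M) $$ (k, l)
          = mat m m (\<lambda>(k, l). d k * G $$ (\<sigma> k, \<sigma> l) * cnj (d l)) $$ (k, l)" using kl by simp
    qed (use G in \<open>auto simp: Mi mat_adjoint_alt\<close>)
  qed
  show ?thesis
  proof
    assume "switching_equivalent m G G'"
    then obtain M where "phase_monomial m M" and G': "M * G * mat_adjoint M = G'"
      unfolding switching_equivalent_def by blast
    then obtain d \<sigma> where d: "\<forall>i<m. cmod (d i) = 1" and \<sigma>: "\<sigma> permutes {..<m}"
      and M: "M = mat_diag m d * mat m m (\<lambda>(i, j). if j = \<sigma> i then 1 else 0)"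
      unfolding phase_monomial_def by blast
    have "G' = mat m m (\<lambda>(k, l). d k * G $$ (\<sigma> k, \<sigma> l) * cnj (d l))"
      using conj[OF M \<sigma>] G' by simp
    then show "G' \<in> carrier_mat m m \<and> (\<exists>d \<sigma>. (\<forall>i<m. cmod (d i) = 1) \<and> \<sigma> permutes {..<m} \<and>
       (\<forall>k<m. \<forall>l<m. G' $$ (k, l) = d k * G $$ (\<sigma> k, \<sigma> l) * cnj (d l)))"
      using d \<sigma> by (intro conjI exI[of _ d] exI[of _ \<sigma>]) auto
  next
    assume "G' \<in> carrier_mat m m \<and> (\<exists>d \<sigma>. (\<forall>i<m. cmod (d i) = 1) \<and> \<sigma> permutes {..<m} \<and>
       (\<forall>k<m. \<forall>l<m. G' $$ (k, l) = d k * G $$ (\<sigma> k, \<sigma> l) * cnj (d l)))"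
    then obtain d \<sigma> where G': "G' \<in> carrier_mat m m" and d: "\<forall>i<m. cmod (d i) = 1"
      and \<sigma>: "\<sigma> permutes {..<m}"
      and eq: "\<forall>k<m. \<forall>l<m. G' $$ (k, l) = d k * G $$ (\<sigma> k, \<sigma> l) * cnj (d l)" by blast
    have "G' = mat m m (\<lambda>(k, l). d k * G $$ (\<sigma> k, \<sigma> l) * cnj (d l))"
      using G' eq by (intro eq_matI) auto
    then show "switching_equivalent m G G'"
      unfolding switching_equivalent_def phase_monomial_def
      using conj[OF refl \<sigma>, of d] d \<sigma>
      by (intro exI[of _ "mat_diag m d * mat m m (\<lambda>(i, j). if j = \<sigma> i then 1 else 0)"] conjI
          exI[of _ d] exI[of _ \<sigma>]) simp_all
  qed
qed

text \<open>Periodicity is asked only where a negative difference wraps around, so neither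
  \<open>k\<close> nor \<open>k + n\<close> is 0. The function supplied later for \<open>P\<close>
  has its value at 0 set by hand and is not periodic on all integers.\<close>

lemma circulantI:
  assumes "A \<in> carrier_mat n n" "n \<ge> 1"
    and "\<And>i j. i < n \<Longrightarrow> j < n \<Longrightarrow> A $$ (i, j) = p (int j - int i)"
    and "\<And>k. - int n < k \<Longrightarrow> k < 0 \<Longrightarrow> p (k + int n) = p k"
  shows "circulant n A"
  unfolding circulant_def
proof (intro conjI exI[of _ "\<lambda>k. p (int k)"] allI impI)
  fix i j assume ij: "i < n" "j < n"
  have "(int j - int i) mod int n = (if i \<le> j then int j - int i else int j - int i + int n)"
  proof (cases "i \<le> j")
    case True
    then show ?thesis using ij by simp
  next
    case False
    have "(int j - int i) mod int n = (int j - int i + int n) mod int n" by simp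
    also have "\<dots> = int j - int i + int n" using ij False by (intro mod_pos_pos_trivial) auto
    finally show ?thesis using False by simp
  qed
  moreover have "p (int j - int i + int n) = p (int j - int i)" if "\<not> i \<le> j"
    using that ij by (intro assms(4)) auto
  ultimately have "p ((int j - int i) mod int n) = p (int j - int i)" by simp
  then show "A $$ (i, j) = p (int (nat ((int j - int i) mod int n)))"
    using assms(2) assms(3)[OF ij] by simp
qed (rule assms(1))

lemma negacirculantI:
  assumes "A \<in> carrier_mat n n"
    and "\<And>i j. i < n \<Longrightarrow> j < n \<Longrightarrow> A $$ (i, j) = p (int j - int i)"
    and "\<And>k. - int n < k \<Longrightarrow> k < 0 \<Longrightarrow> p (k + int n) = - p k"
  shows "negacirculant n A"
  unfolding negacirculant_def
proof (intro conjI exI[of _ "\<lambda>k. p (int k)"] allI impI)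
  fix i j assume ij: "i < n" "j < n"
  have "p (int j - int i + int n) = - p (int j - int i)" if "\<not> i \<le> j"
    using that ij by (intro assms(3)) auto
  moreover have "int (n + j - i) = int j - int i + int n" using ij by simp
  ultimately show "A $$ (i, j) = (if i \<le> j then p (int (j - i)) else - p (int (n + j - i)))"
    using assms(2)[OF ij] by (simp add: of_nat_diff)
qed (rule assms(1))

lemma sum_lessThan_add:
  fixes f :: "nat \<Rightarrow> 'a :: comm_monoid_add"
  shows "(\<Sum>j<n + m. f j) = (\<Sum>j<n. f j) + (\<Sum>j<m. f (n + j))"
  by (induction m) (simp_all add: add.assoc)

lemma inverse_sqrt_order:
  assumes "n \<ge> 1" "r = 1 / sqrt (2 * real n - 1)"
  shows "r > 0" "r\<^sup>2 * (real (2 * n) - 1) = 1"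
  using assms by (simp_all add: power_divide)

definition (in dihedral_orbit) orbit_vec :: "nat \<Rightarrow> complex vec" where
  "orbit_vec j = (if j < n then u (int j) else w (int (j - n)))"

text \<open>The phases \<open>c\<close> absorb the passage from \<open>\<pi>\<close> to its normal
  form. Norms, moduli of inner products and the frame condition do not see them, and switching can
  remove them from the Gram matrix.\<close>

locale dihedral_frame = dihedral_orbit +
  fixes \<Phi> :: "complex mat" and c :: "nat \<Rightarrow> complex"
  assumes \<Phi>: "\<Phi> \<in> carrier_mat n (2 * n)"
    and c: "j < 2 * n \<Longrightarrow> cmod (c j) = 1"
    and col_\<Phi>: "j < 2 * n \<Longrightarrow> col \<Phi> j = c j \<cdot>\<^sub>v orbit_vec j"
begin

lemma orbit_vec_carrier: "orbit_vec j \<in> carrier_vec n"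
  by (simp add: orbit_vec_def u_carrier w_carrier)

lemma orbit_gram:
  "orbit_vec l \<bullet>c orbit_vec k =
    (if k < n then if l < n then a (int l - int k) else b (int (l - n) - int k)
     else if l < n then b (int (k - n) - int l) else a (int (k - n) - int (l - n)))"
proof -
  have "u (int l) \<bullet>c w (int (k - n)) = b (int (k - n) - int l)"
    using cscalar_prod_commute[OF w_carrier u_carrier, of "int (k - n)" "int l"]
    by (simp add: wu b_cnj)
  then show ?thesis
    by (cases "k < n"; cases "l < n") (simp_all add: orbit_vec_def uu wu ww)
qed

lemma orbit_norm: "orbit_vec k \<bullet>c orbit_vec k = 1"
  by (simp add: orbit_gram a_0)

lemma c_cnj: "j < 2 * n \<Longrightarrow> c j * cnj (c j) = 1"
  using c[of j] by (simp add: complex_norm_square[symmetric])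

lemma cscalar_col:
  assumes "x \<in> carrier_vec n" "j < 2 * n"
  shows "x \<bullet>c col \<Phi> j = cnj (c j) * (x \<bullet>c orbit_vec j)"
  using assms orbit_vec_carrier[of j] by (simp add: col_\<Phi> conjugate_smult_vec)

lemma cmod_cscalar_col:
  "x \<in> carrier_vec n \<Longrightarrow> j < 2 * n \<Longrightarrow> cmod (x \<bullet>c col \<Phi> j) = cmod (x \<bullet>c orbit_vec j)"
  by (simp add: cscalar_col norm_mult c)

lemma col_gram:
  assumes "k < 2 * n" "l < 2 * n"
  shows "col \<Phi> l \<bullet>c col \<Phi> k = c l * cnj (c k) * (orbit_vec l \<bullet>c orbit_vec k)"
  using assms orbit_vec_carrier[of k] orbit_vec_carrier[of l]
  by (simp add: col_\<Phi> conjugate_smult_vec)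

lemma gram_carrier: "mat_adjoint \<Phi> * \<Phi> \<in> carrier_mat (2 * n) (2 * n)"
  using \<Phi> mat_adjoint_carrier[OF \<Phi>] by simp

text \<open>The indices change sides because \<open>\<bullet>c\<close> conjugates its second
  argument.\<close>

lemma gram_index:
  assumes "k < 2 * n" "l < 2 * n"
  shows "(mat_adjoint \<Phi> * \<Phi>) $$ (k, l) = c l * cnj (c k) * (orbit_vec l \<bullet>c orbit_vec k)"
proof -
  have "(mat_adjoint \<Phi> * \<Phi>) $$ (k, l) = col \<Phi> l \<bullet>c col \<Phi> k"
    using \<Phi> assms by (simp add: mat_adjoint_alt scalar_prod_def mult.commute)
  then show ?thesis using col_gram[OF assms] by simp
qed

lemma frame_cols_iff:
  "tight_frame (2 * n) n \<Phi> \<longleftrightarrow> (\<exists>A::real. A > 0 \<and> (\<forall>x\<in>carrier_vec n.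
     (\<Sum>j<2 * n. (cmod (x \<bullet>c orbit_vec j))\<^sup>2) = A * Re (x \<bullet>c x)))"
  using \<Phi> by (simp add: tight_frame_def cmod_cscalar_col)

lemma is_ETF_iff:
  "is_ETF (2 * n) n \<Phi> \<longleftrightarrow> tight_frame (2 * n) n \<Phi> \<and>
     (\<exists>\<alpha>. \<forall>i<2 * n. \<forall>j<2 * n. i \<noteq> j \<longrightarrow> cmod (orbit_vec i \<bullet>c orbit_vec j) = \<alpha>)"
proof -
  have "col \<Phi> j \<bullet>c col \<Phi> j = 1" if "j < 2 * n" for j
    using that by (simp add: col_gram orbit_norm c_cnj)
  moreover have "cmod (col \<Phi> i \<bullet>c col \<Phi> j) = cmod (orbit_vec i \<bullet>c orbit_vec j)"
    if "i < 2 * n" "j < 2 * n" for i j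
    using that by (simp add: col_gram norm_mult c)
  ultimately show ?thesis unfolding is_ETF_def by simp
qed

lemma orbit_independent_iff:
  "lin_indep_family n orbit_vec \<longleftrightarrow> lin_indep_family n (\<lambda>k. u (int k))"
  unfolding lin_indep_family_def by (simp add: orbit_vec_def)

text \<open>The Hadamard property gives \<open>T\<^sup>2 = 2 T\<close> for the target
  \<open>T\<close>. Undoing the switching carries this to the orbit vectors as the frame identity on
  the first \<open>n\<close> of them. Off the diagonal, \<open>T\<close> has modulus
  \<open>r\<close> because \<open>H\<close> consists of signs.\<close>

lemma ETF_of_skew_hadamard:
  assumes PQ: "P \<in> carrier_mat n n" "Q \<in> carrier_mat n n"
    and had: "skew_hadamard (2 * n) (skew_block P Q)"
    and switch: "switching_equivalent (2 * n) (mat_adjoint \<Phi> * \<Phi>) (target_gram n P Q)"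
  shows "is_ETF (2 * n) n \<Phi> \<and> lin_indep_family n (\<lambda>k. u (int k))"
proof -
  define r where "r = 1 / sqrt (2 * real n - 1)"
  note r = inverse_sqrt_order[OF n r_def]
  define H where "H k l = skew_block P Q $$ (k, l)" for k l
  define T where "T k l = target_gram n P Q $$ (k, l)" for k l
  have H: "H k l \<in> {1, -1}" "(\<Sum>j<2 * n. H k j * H l j) = (if k = l then real (2 * n) else 0)"
    "H k l + H l k = (if k = l then 2 else 0)" if "k < 2 * n" "l < 2 * n" for k l
    using had that unfolding skew_hadamard_iff H_def by blast+
  have T: "T k l = (if k = l then 1 else 0) + \<i> * of_real r * block_phase n k * cnj (block_phase n l) *
      of_real (H k l - (if k = l then 1 else 0))" if "k < 2 * n" "l < 2 * n" for k l
    unfolding T_def H_def r_def by (rule target_gram_index[OF PQ that])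
  have TT: "(\<Sum>j<2 * n. T k j * T j l) = 2 * T k l" if "k < 2 * n" "l < 2 * n" for k l
    using skew_gram_square_iff[OF cmod_block_phase r(2) H(3) T that] H(2)[OF that] by blast
  obtain d \<sigma> where d: "\<And>i. i < 2 * n \<Longrightarrow> cmod (d i) = 1" and \<sigma>: "\<sigma> permutes {..<2 * n}"
    and dT: "\<And>k l. k < 2 * n \<Longrightarrow> l < 2 * n \<Longrightarrow>
      T k l = d k * (mat_adjoint \<Phi> * \<Phi>) $$ (\<sigma> k, \<sigma> l) * cnj (d l)"
    using switch unfolding switching_equivalent_iff[OF gram_carrier] T_def by blast
  \<comment> \<open>Switching expresses \<open>T\<close> by permuted Gram entries; the inverse
    permutation expresses each Gram entry by \<open>T\<close>.\<close>
  define \<tau> where "\<tau> = inv_into UNIV \<sigma>"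
  have \<tau>: "\<tau> permutes {..<2 * n}" unfolding \<tau>_def using \<sigma> by (rule permutes_inv)
  have \<tau>m: "\<tau> k < 2 * n" if "k < 2 * n" for k using permutes_in_image[OF \<tau>, of k] that by simp
  have \<tau>_inj: "\<tau> k = \<tau> l \<longleftrightarrow> k = l" for k l using permutes_inj[OF \<tau>] by (simp add: inj_eq)
  have \<sigma>\<tau>: "\<sigma> (\<tau> k) = k" for k unfolding \<tau>_def using \<sigma> by (rule permutes_inverses)
  \<comment> \<open>Column phase and switching phase merged into one.\<close>
  define f where "f k = c k * cnj (d (\<tau> k))" for k
  have f: "cmod (f k) = 1" if "k < 2 * n" for k
    using that \<tau>m by (simp add: f_def norm_mult c d)
  have f': "cnj (f k) * f k = 1" if "k < 2 * n" for k
    using f[OF that] by (simp add: complex_norm_square[symmetric] mult.commute)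
  have gram: "orbit_vec l \<bullet>c orbit_vec k = f k * cnj (f l) * T (\<tau> k) (\<tau> l)"
    if kl: "k < 2 * n" "l < 2 * n" for k l
  proof -
    have "d k * cnj (d k) = 1" if "k < 2 * n" for k
      using d[OF that] by (simp add: complex_norm_square[symmetric])
    note dd = this[OF \<tau>m]
    have "T (\<tau> k) (\<tau> l) = d (\<tau> k) * (c l * cnj (c k) * (orbit_vec l \<bullet>c orbit_vec k)) * cnj (d (\<tau> l))"
      using dT[OF \<tau>m \<tau>m, OF kl] gram_index[OF kl] by (simp add: \<sigma>\<tau>)
    then have "f k * cnj (f l) * T (\<tau> k) (\<tau> l) = (d (\<tau> k) * cnj (d (\<tau> k))) * (d (\<tau> l) * cnj (d (\<tau> l)))
        * (c k * cnj (c k)) * (c l * cnj (c l)) * (orbit_vec l \<bullet>c orbit_vec k)"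
      by (simp add: f_def mult_ac)
    then show ?thesis using kl by (simp add: dd c_cnj)
  qed
  have indep: "lin_indep_family n (\<lambda>k. u (int k))"
  \<comment> \<open>The Hadamard order 2 is not divisible by 4, but a single unit vector is
    independent anyway.\<close>
  proof (cases "n = 1")
    case True
    then show ?thesis
      using u_carrier by (subst lin_indep_family_iff_gram) (auto simp: uu a_0)
  next
    case False
    then have "4 dvd 2 * n" using hadamard_order_dvd[of "2 * n" H] H n by simp
    then have even: "even n" by presburger
    show ?thesis
    proof (rule lin_indep_of_skew_phases[OF even r_def,
          where e = "\<lambda>k. f k * block_phase n (\<tau> k)" and S = "\<lambda>k l. of_real (H (\<tau> k) (\<tau> l))"])
      show "cmod (f k * block_phase n (\<tau> k)) = 1" if "k < n" for k
        using f[of k] that by (simp add: norm_mult cmod_block_phase)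
      show "complex_of_real (H (\<tau> k) (\<tau> l)) \<in> {1, -1}" if "k < n" "l < n" for k l
        using H(1)[OF \<tau>m \<tau>m, of k l] that by auto
      show "a (int l - int k) = \<i> * of_real r * (f k * block_phase n (\<tau> k)) *
          cnj (f l * block_phase n (\<tau> l)) * complex_of_real (H (\<tau> k) (\<tau> l))"
        if kl: "k < n" "l < n" "k \<noteq> l" for k l
      proof -
        have "a (int l - int k) = orbit_vec l \<bullet>c orbit_vec k" using kl by (simp add: orbit_gram)
        also have "\<dots> = f k * cnj (f l) * T (\<tau> k) (\<tau> l)" using kl by (intro gram) auto
        also have "T (\<tau> k) (\<tau> l) = \<i> * of_real r * block_phase n (\<tau> k) * cnj (block_phase n (\<tau> l)) *
            of_real (H (\<tau> k) (\<tau> l))"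
          using T[OF \<tau>m \<tau>m, of k l] kl by (simp add: \<tau>_inj)
        finally show ?thesis by (simp add: mult_ac)
      qed
    qed
  qed
  \<comment> \<open>By \<open>frame_identity_extend\<close> only pairs among the first
    \<open>n\<close> vectors matter. The phases of the summation index cancel, and
    \<open>\<tau>\<close> merely permutes the terms of the matrix product.\<close>
  have frame: "(\<Sum>j<2 * n. (orbit_vec k \<bullet>c orbit_vec j) * (orbit_vec j \<bullet>c orbit_vec l))
      = 2 * (orbit_vec k \<bullet>c orbit_vec l)" if "k < n" "l < n" for k l
  proof -
    have kl: "k < 2 * n" "l < 2 * n" using that by auto
    have "(\<Sum>j<2 * n. (orbit_vec k \<bullet>c orbit_vec j) * (orbit_vec j \<bullet>c orbit_vec l))
        = (\<Sum>j<2 * n. f l * cnj (f k) * (T (\<tau> l) (\<tau> j) * T (\<tau> j) (\<tau> k)))"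
    proof (rule sum.cong[OF refl])
      fix j assume "j \<in> {..<2 * n}"
      then have j: "j < 2 * n" by simp
      have "(orbit_vec k \<bullet>c orbit_vec j) * (orbit_vec j \<bullet>c orbit_vec l)
          = (cnj (f j) * f j) * (f l * cnj (f k) * (T (\<tau> l) (\<tau> j) * T (\<tau> j) (\<tau> k)))"
        unfolding gram[OF j kl(1)] gram[OF kl(2) j] by (simp add: mult_ac)
      then show "(orbit_vec k \<bullet>c orbit_vec j) * (orbit_vec j \<bullet>c orbit_vec l)
          = f l * cnj (f k) * (T (\<tau> l) (\<tau> j) * T (\<tau> j) (\<tau> k))"
        unfolding f'[OF j] by simp
    qed
    also have "\<dots> = f l * cnj (f k) * (\<Sum>j<2 * n. T (\<tau> l) (\<tau> j) * T (\<tau> j) (\<tau> k))"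
      by (simp add: sum_distrib_left)
    also have "(\<Sum>j<2 * n. T (\<tau> l) (\<tau> j) * T (\<tau> j) (\<tau> k)) = (\<Sum>j<2 * n. T (\<tau> l) j * T j (\<tau> k))"
      using sum.permute[OF \<tau>, of "\<lambda>j. T (\<tau> l) j * T j (\<tau> k)"] by (simp add: o_def)
    also have "\<dots> = 2 * T (\<tau> l) (\<tau> k)" using TT \<tau>m kl by simp
    finally show ?thesis by (simp add: gram kl)
  qed
  have "tight_frame (2 * n) n \<Phi>"
    unfolding frame_cols_iff
  proof (intro exI[of _ 2] conjI ballI)
    fix x :: "complex vec" assume x: "x \<in> carrier_vec n"
    have "complex_of_real (\<Sum>j<2 * n. (cmod (x \<bullet>c orbit_vec j))\<^sup>2)
        = (\<Sum>j<2 * n. (x \<bullet>c orbit_vec j) * (orbit_vec j \<bullet>c x))"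
      using cscalar_prod_commute[OF x orbit_vec_carrier]
      by (simp add: complex_norm_square del: of_real_power)
    also have "\<dots> = 2 * (x \<bullet>c x)"
      using frame_identity_extend[of "2 * n" orbit_vec n 2 x] orbit_vec_carrier indep frame x
      by (simp add: orbit_independent_iff)
    finally show "(\<Sum>j<2 * n. (cmod (x \<bullet>c orbit_vec j))\<^sup>2) = 2 * Re (x \<bullet>c x)"
      by (simp add: complex_eq_iff)
  qed simp
  moreover have "cmod (orbit_vec i \<bullet>c orbit_vec j) = r" if "i < 2 * n" "j < 2 * n" "i \<noteq> j" for i j
    using gram[OF that(2,1)] T[OF \<tau>m \<tau>m, OF that(2,1)] H(1)[OF \<tau>m \<tau>m, OF that(2,1)] r(1) that
    by (auto simp: \<tau>_inj norm_mult f cmod_block_phase)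
  ultimately show ?thesis using indep unfolding is_ETF_iff by blast
qed

text \<open>\<open>P\<close> and \<open>Q\<close> are read off from \<open>a\<close> and
  \<open>b\<close>, and the order of the vectors is kept. The factor \<open>Re z\<close> in the
  wrap-around rule lets one argument serve both the circulant and the negacirculant case.\<close>

lemma skew_hadamard_of_ETF:
  assumes etf: "is_ETF (2 * n) n \<Phi>" and indep: "lin_indep_family n (\<lambda>k. u (int k))"
  shows "\<exists>P Q p q. P \<in> carrier_mat n n \<and> Q \<in> carrier_mat n n \<and>
    (\<forall>i<n. \<forall>j<n. P $$ (i, j) = p (int j - int i) \<and> Q $$ (i, j) = q (int j - int i)) \<and>
    (\<forall>k. - int n < k \<longrightarrow> k < 0 \<longrightarrow> p (k + int n) = Re z * p k \<and> q (k + int n) = Re z * q k) \<and>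
    skew_hadamard (2 * n) (skew_block P Q) \<and>
    switching_equivalent (2 * n) (mat_adjoint \<Phi> * \<Phi>) (target_gram n P Q)"
proof -
  define r where "r = 1 / sqrt (2 * real n - 1)"
  note r = inverse_sqrt_order[OF n r_def]
  have tight: "tight_frame (2 * n) n \<Phi>"
    and ex: "\<exists>\<alpha>. \<forall>i<2 * n. \<forall>j<2 * n. i \<noteq> j \<longrightarrow> cmod (orbit_vec i \<bullet>c orbit_vec j) = \<alpha>"
    using etf by (simp_all add: is_ETF_iff)
  from tight obtain A :: real where A: "\<And>x. x \<in> carrier_vec n \<Longrightarrow>
      (\<Sum>j<2 * n. (cmod (x \<bullet>c orbit_vec j))\<^sup>2) = A * Re (x \<bullet>c x)"
    by (auto simp: frame_cols_iff)
  from ex obtain \<alpha> where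
    \<alpha>: "\<And>i j. i < 2 * n \<Longrightarrow> j < 2 * n \<Longrightarrow> i \<noteq> j \<Longrightarrow> cmod (orbit_vec i \<bullet>c orbit_vec j) = \<alpha>"
    by auto
  have "A * n = (2 * n :: nat)"
    using orbit_vec_carrier orbit_norm A by (intro frame_constant[of "2 * n" orbit_vec n A]) auto
  then have A2: "A = 2" using n by simp
  have frame: "(\<Sum>j<2 * n. (x \<bullet>c orbit_vec j) * (orbit_vec j \<bullet>c y)) = 2 * (x \<bullet>c y)"
    if "x \<in> carrier_vec n" "y \<in> carrier_vec n" for x y
    using frame_identity_polarize[of "2 * n" orbit_vec n A x y] orbit_vec_carrier A that A2 by simp
  \<comment> \<open>The frame identity at the unit vector \<open>orbit_vec 0\<close> reads
    \<open>2 = 1 + (2 n - 1) \<alpha>\<^sup>2\<close>, which fixes the common modulus.\<close>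
  have "2 = (\<Sum>j<2 * n. (cmod (orbit_vec 0 \<bullet>c orbit_vec j))\<^sup>2)"
    using A[OF orbit_vec_carrier[of 0]] by (simp add: A2 orbit_norm)
  also have "\<dots> = (cmod (orbit_vec 0 \<bullet>c orbit_vec 0))\<^sup>2 + (\<Sum>j\<in>{..<2 * n} - {0}. (cmod (orbit_vec 0 \<bullet>c orbit_vec j))\<^sup>2)"
    using n by (intro sum.remove) auto
  also have "(\<Sum>j\<in>{..<2 * n} - {0}. (cmod (orbit_vec 0 \<bullet>c orbit_vec j))\<^sup>2) = (\<Sum>j\<in>{..<2 * n} - {0}. \<alpha>\<^sup>2)"
    using \<alpha> n by (intro sum.cong) auto
  also have "\<dots> = \<alpha>\<^sup>2 * (real (2 * n) - 1)" using n by (simp add: card_Diff_singleton of_nat_diff)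
  finally have "\<alpha>\<^sup>2 * (real (2 * n) - 1) = r\<^sup>2 * (real (2 * n) - 1)" using r(2) by (simp add: orbit_norm)
  then have "\<alpha>\<^sup>2 = r\<^sup>2" using n by (subst (asm) mult_cancel_right) auto
  moreover have "\<alpha> \<ge> 0" using \<alpha>[of 0 n] n norm_ge_zero[of "orbit_vec 0 \<bullet>c orbit_vec n"] by simp
  ultimately have \<alpha>r: "\<alpha> = r" using r(1) by (simp add: power2_eq_iff_nonneg)
  have zero: "a (int j) + a (- int j) = 0" if "0 < j" "j < n" for j
  proof (rule real_part_zero[OF _ indep that])
    fix x y :: "complex vec" assume "x \<in> carrier_vec n" "y \<in> carrier_vec n"
    from frame[OF this]
    show "(\<Sum>k<n. (x \<bullet>c u (int k)) * (u (int k) \<bullet>c y)) + (\<Sum>k<n. (x \<bullet>c w (int k)) * (w (int k) \<bullet>c y))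
      = 2 * (x \<bullet>c y)"
      by (simp add: mult_2[of n] sum_lessThan_add orbit_vec_def)
  qed
  have a_im: "Im (a (int l - int k)) / r \<in> {1, -1}"
    "a (int l - int k) = \<i> * of_real (Im (a (int l - int k)))"
    if kl: "k < n" "l < n" "k \<noteq> l" for k l
  proof -
    have "cmod (a (int l - int k)) = r"
      using \<alpha>[of l k] kl by (simp add: \<alpha>r orbit_gram)
    moreover have "a (int l - int k) + a (- (int l - int k)) = 0"
    proof (cases "k < l")
      case True
      then show ?thesis using zero[of "l - k"] kl by (simp add: of_nat_diff)
    next
      case False
      then show ?thesis using zero[of "k - l"] kl by (simp add: of_nat_diff add.commute)
    qed
    \<comment> \<open>Since \<open>a (- m)\<close> is the conjugate of \<open>a m\<close>, the
      vanishing sum is twice the real part.\<close>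
    then have "Re (a (int l - int k)) = 0"
      using a_cnj[of "int l - int k"] by (simp add: complex_eq_iff)
    ultimately show "a (int l - int k) = \<i> * of_real (Im (a (int l - int k)))"
      "Im (a (int l - int k)) / r \<in> {1, -1}"
      using r(1) by (auto simp: complex_eq_iff cmod_def abs_if field_simps split: if_splits)
  qed
  have b_re: "Re (b (int l - int k)) / r \<in> {1, -1}" "b (int l - int k) = of_real (Re (b (int l - int k)))"
    if kl: "k < n" "l < n" for k l
  proof -
    have "cmod (b (int l - int k)) = r"
      using \<alpha>[of "l + n" k] kl by (simp add: \<alpha>r orbit_gram)
    moreover have "Im (b (int l - int k)) = 0"
      using b_cnj[of "int l - int k"] by (simp add: complex_eq_iff)
    ultimately show "b (int l - int k) = of_real (Re (b (int l - int k)))"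
      "Re (b (int l - int k)) / r \<in> {1, -1}"
      using r(1) by (auto simp: complex_eq_iff cmod_def abs_if field_simps split: if_splits)
  qed
  \<comment> \<open>The value 1 at 0 gives \<open>P\<close> the unit diagonal of a skew Hadamard
    matrix; the entry \<open>a 0 = 1\<close> itself is accounted for by the identity summand of the
    target.\<close>
  define p where "p k = (if k = 0 then 1 else Im (a k) / r)" for k
  define q where "q k = Re (b k) / r" for k
  define P where "P = mat n n (\<lambda>(i, j). p (int j - int i))"
  define Q where "Q = mat n n (\<lambda>(i, j). q (int j - int i))"
  have PQ: "P \<in> carrier_mat n n" "Q \<in> carrier_mat n n" by (simp_all add: P_def Q_def)
  have zr: "z = of_real (Re z)" using z by (auto simp: power2_eq_1_iff)
  have per: "p (k + int n) = Re z * p k \<and> q (k + int n) = Re z * q k" if "- int n < k" "k < 0" for k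
  proof
    have "Im (a (k + int n)) = Re z * Im (a k)" "Re (b (k + int n)) = Re z * Re (b k)"
      by (subst a_period b_period, subst zr, simp)+
    then show "p (k + int n) = Re z * p k" "q (k + int n) = Re z * q k"
      using that by (simp_all add: p_def q_def)
  qed
  define H where "H k l = skew_block P Q $$ (k, l)" for k l
  have H: "H k l = (if k < n then if l < n then p (int l - int k) else q (int (l - n) - int k)
     else if l < n then - q (int (k - n) - int l) else p (int (k - n) - int (l - n)))"
    if "k < 2 * n" "l < 2 * n" for k l
    unfolding H_def skew_block_index[OF PQ that] using that by (auto simp: P_def Q_def)
  have p_pm: "p (int l - int k) \<in> {1, -1}" "of_real r * \<i> * of_real (p (int l - int k) - (if k = l then 1 else 0))
      = a (int l - int k) - (if k = l then 1 else 0)" if "k < n" "l < n" for k l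
    using a_im[OF that] r(1) a_0 by (auto simp: p_def)
  have q_pm: "q (int l - int k) \<in> {1, -1}" "of_real r * of_real (q (int l - int k)) = b (int l - int k)"
    if "k < n" "l < n" for k l
    using b_re[OF that] r(1) by (auto simp: q_def)
  have skew: "H k l + H l k = (if k = l then 2 else 0)" if kl: "k < 2 * n" "l < 2 * n" for k l
  proof -
    have "p k + p (- k) = 0" if "k \<noteq> 0" for k
    proof -
      have "Im (a (- k)) = - Im (a k)" using a_cnj[of k] by (simp add: complex_eq_iff)
      then show ?thesis using that by (simp add: p_def)
    qed
    from this[of "int l - int k"] this[of "int (k - n) - int (l - n)"] show ?thesis
      using kl by (auto simp: H p_def split: if_splits)
  qed
  have gram: "target_gram n P Q $$ (k, l) = orbit_vec l \<bullet>c orbit_vec k"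
    if kl: "k < 2 * n" "l < 2 * n" for k l
  proof -
    have small: "k - n < n" "l - n < n" using kl by auto
    have eq: "l - n = k - n \<longleftrightarrow> k = l" if "\<not> k < n" "\<not> l < n" using that by auto
    show ?thesis
      unfolding target_gram_index[OF PQ kl] orbit_gram H_def[symmetric] r_def[symmetric] H[OF kl]
      using p_pm(2)[of k l] q_pm(2)[of k "l - n", OF _ small(2)] q_pm(2)[of l "k - n", OF _ small(1)]
        p_pm(2)[OF small(2,1)] eq
      by (cases "k < n"; cases "l < n") (auto simp: block_phase_def algebra_simps split: if_splits)
  qed
  have "skew_hadamard (2 * n) (skew_block P Q)"
    unfolding skew_hadamard_iff H_def[symmetric]
  proof (intro conjI allI impI)
    show "skew_block P Q \<in> carrier_mat (2 * n) (2 * n)"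
      using PQ by (auto simp: skew_block_def mult_2)
    fix k l assume kl: "k < 2 * n" "l < 2 * n"
    show "H k l \<in> {1, -1}"
      unfolding H[OF kl]
      using p_pm(1)[of k l] q_pm(1)[of k "l - n"] q_pm(1)[of l "k - n"] p_pm(1)[of "l - n" "k - n"] kl
      by auto
    show "H k l + H l k = (if k = l then 2 else 0)" using kl by (rule skew)
    have T: "target_gram n P Q $$ (k, l) = (if k = l then 1 else 0) +
        \<i> * of_real r * block_phase n k * cnj (block_phase n l) * of_real (H k l - (if k = l then 1 else 0))"
      if "k < 2 * n" "l < 2 * n" for k l
      unfolding H_def r_def by (rule target_gram_index[OF PQ that])
    \<comment> \<open>The polarized frame identity is \<open>G\<^sup>2 = 2 G\<close> for the Gram
      matrix, which \<open>skew_gram_square_iff\<close> translates into orthogonality of the rows of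
      \<open>H\<close>.\<close>
    have "(\<Sum>j<2 * n. target_gram n P Q $$ (k, j) * target_gram n P Q $$ (j, l))
        = (\<Sum>j<2 * n. (orbit_vec l \<bullet>c orbit_vec j) * (orbit_vec j \<bullet>c orbit_vec k))"
      using kl by (intro sum.cong) (auto simp: gram)
    also have "\<dots> = 2 * target_gram n P Q $$ (k, l)"
      using kl by (simp add: frame orbit_vec_carrier gram)
    finally show "(\<Sum>j<2 * n. H k j * H l j) = (if k = l then real (2 * n) else 0)"
      using skew_gram_square_iff[OF cmod_block_phase r(2) skew T kl] by blast
  qed
  moreover have "switching_equivalent (2 * n) (mat_adjoint \<Phi> * \<Phi>) (target_gram n P Q)"
    unfolding switching_equivalent_iff[OF gram_carrier]
  proof (intro conjI exI[of _ c] exI[of _ id] allI impI)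
    fix k l assume kl: "k < 2 * n" "l < 2 * n"
    have "c k * (mat_adjoint \<Phi> * \<Phi>) $$ (id k, id l) * cnj (c l)
        = (c k * cnj (c k)) * (c l * cnj (c l)) * (orbit_vec l \<bullet>c orbit_vec k)"
      by (simp add: gram_index[OF kl] mult_ac)
    then show "target_gram n P Q $$ (k, l) = c k * (mat_adjoint \<Phi> * \<Phi>) $$ (id k, id l) * cnj (c l)"
      using kl by (simp add: gram c_cnj)
  qed (use c target_gram_carrier[OF PQ] in \<open>auto simp: permutes_id\<close>)
  ultimately show ?thesis
    using PQ per by (intro exI[of _ P] exI[of _ Q] exI[of _ p] exI[of _ q]) (auto simp: P_def Q_def)
qed

end

section \<open>From projective representations to orbit frames\<close>

lemma normal_form_frame:
  assumes n: "n \<ge> 1" and z: "z\<^sup>2 = 1" and nf: "dihedral_normal_form n \<pi> z U W"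
    and v: "v \<in> carrier_vec n" "v \<bullet>c v = 1"
  shows "\<exists>u w a b c. dihedral_frame n z u w a b (config_mat n \<pi> v) c \<and>
    (regular_configuration n \<pi> v \<longleftrightarrow> lin_indep_family n (\<lambda>k. u (int k)))"
proof -
  obtain u w a b where orbit: "dihedral_orbit n z u w a b" and u0: "u 0 = v"
    and F: "\<And>k. k < n \<Longrightarrow> \<exists>c. cmod c = 1 \<and> \<pi> (k, False) *\<^sub>v v = c \<cdot>\<^sub>v u (int k)"
    and T: "\<And>k. k < n \<Longrightarrow> \<exists>c. cmod c = 1 \<and> \<pi> (k, True) *\<^sub>v v = c \<cdot>\<^sub>v w (int k)"
    using normal_form_orbit[OF assms] by blast
  interpret dihedral_orbit n z u w a b by (rule orbit)
  have ex: "\<exists>c. cmod c = 1 \<and> \<pi> (dih_elem n j) *\<^sub>v v = c \<cdot>\<^sub>v orbit_vec j" if "j < 2 * n" for j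
    using F[of j] T[of "j - n"] that by (cases "j < n") (simp_all add: dih_elem_eq orbit_vec_def)
  then obtain c where c: "\<And>j. j < 2 * n \<Longrightarrow> cmod (c j) = 1"
    "\<And>j. j < 2 * n \<Longrightarrow> \<pi> (dih_elem n j) *\<^sub>v v = c j \<cdot>\<^sub>v orbit_vec j" by metis
  have "orbit_vec j \<in> carrier_vec n" for j by (simp add: orbit_vec_def u_carrier w_carrier)
  then have "dihedral_frame n z u w a b (config_mat n \<pi> v) c"
    using c by unfold_locales (auto simp: config_mat_def col_mat_of_cols)
  moreover have "regular_configuration n \<pi> v \<longleftrightarrow> lin_indep_family n (\<lambda>k. u (int k))"
    using n v(1) u0 u_carrier F by (intro regular_configuration_iff) auto
  ultimately show ?thesis by blast
qed

theorem theorem4p21: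
  fixes n :: nat and \<pi> :: "nat \<times> bool \<Rightarrow> complex mat" and v :: "complex vec"
    and \<Phi> :: "complex mat"
  assumes "n \<ge> 1" and "\<Phi> = config_mat n \<pi> v"
  shows "(strict_configuration n \<pi> v \<longrightarrow>
            (is_ETF (2 * n) n \<Phi> \<and> regular_configuration n \<pi> v \<longleftrightarrow>
             (\<exists>P Q. circulant n P \<and> circulant n Q \<and>
                skew_hadamard (2 * n) (skew_block P Q) \<and>
                switching_equivalent (2 * n) (mat_adjoint \<Phi> * \<Phi>) (target_gram n P Q)))) \<and>
         (genuine_projective_configuration n \<pi> v \<longrightarrow>
            (is_ETF (2 * n) n \<Phi> \<and> regular_configuration n \<pi> v \<longleftrightarrow>
             (\<exists>P Q. negacirculant n P \<and> negacirculant n Q \<and>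
                skew_hadamard (2 * n) (skew_block P Q) \<and>
                switching_equivalent (2 * n) (mat_adjoint \<Phi> * \<Phi>) (target_gram n P Q))))"
proof (intro conjI impI)
  assume strict: "strict_configuration n \<pi> v"
  then obtain \<pi>' where \<pi>': "strict_rep n \<pi>'" "equivalent_reps n \<pi> \<pi>'" and proj: "proj_unitary_rep n \<pi>"
    and v: "v \<in> carrier_vec n" "v \<bullet>c v = 1"
    unfolding strict_configuration_def dihedral_configuration_def by blast
  obtain U W where nf: "dihedral_normal_form n \<pi> 1 U W"
    using equivalent_strict_rep_normal_form[OF assms(1) proj \<pi>'] by blast
  obtain u w a b c where fr: "dihedral_frame n 1 u w a b \<Phi> c"
    and reg: "regular_configuration n \<pi> v \<longleftrightarrow> lin_indep_family n (\<lambda>k. u (int k))"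
    using normal_form_frame[OF assms(1) _ nf v] unfolding assms(2) by auto
  interpret dihedral_frame n 1 u w a b \<Phi> c by (rule fr)
  show "is_ETF (2 * n) n \<Phi> \<and> regular_configuration n \<pi> v \<longleftrightarrow>
      (\<exists>P Q. circulant n P \<and> circulant n Q \<and> skew_hadamard (2 * n) (skew_block P Q) \<and>
        switching_equivalent (2 * n) (mat_adjoint \<Phi> * \<Phi>) (target_gram n P Q))"
  proof
    assume "is_ETF (2 * n) n \<Phi> \<and> regular_configuration n \<pi> v"
    then obtain P Q p q where PQ: "P \<in> carrier_mat n n" "Q \<in> carrier_mat n n"
      "\<forall>i<n. \<forall>j<n. P $$ (i, j) = p (int j - int i) \<and> Q $$ (i, j) = q (int j - int i)"
      "\<forall>k. - int n < k \<longrightarrow> k < 0 \<longrightarrow> p (k + int n) = Re 1 * p k \<and> q (k + int n) = Re 1 * q k"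
      "skew_hadamard (2 * n) (skew_block P Q)"
      "switching_equivalent (2 * n) (mat_adjoint \<Phi> * \<Phi>) (target_gram n P Q)"
      using skew_hadamard_of_ETF reg by blast
    moreover have "circulant n P" "circulant n Q"
      using PQ(1-4) assms(1) by (auto intro: circulantI[of _ _ p] circulantI[of _ _ q])
    ultimately show "\<exists>P Q. circulant n P \<and> circulant n Q \<and> skew_hadamard (2 * n) (skew_block P Q) \<and>
        switching_equivalent (2 * n) (mat_adjoint \<Phi> * \<Phi>) (target_gram n P Q)" by blast
  next
    assume "\<exists>P Q. circulant n P \<and> circulant n Q \<and> skew_hadamard (2 * n) (skew_block P Q) \<and>
        switching_equivalent (2 * n) (mat_adjoint \<Phi> * \<Phi>) (target_gram n P Q)"
    then show "is_ETF (2 * n) n \<Phi> \<and> regular_configuration n \<pi> v"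
      using ETF_of_skew_hadamard reg unfolding circulant_def by blast
  qed
next
  assume genuine: "genuine_projective_configuration n \<pi> v"
  then have v: "v \<in> carrier_vec n" "v \<bullet>c v = 1"
    unfolding genuine_projective_configuration_def dihedral_configuration_def by blast+
  obtain U W where nf: "dihedral_normal_form n \<pi> (-1) U W"
    using genuine_configuration_normal_form[OF assms(1) genuine] by blast
  obtain u w a b c where fr: "dihedral_frame n (-1) u w a b \<Phi> c"
    and reg: "regular_configuration n \<pi> v \<longleftrightarrow> lin_indep_family n (\<lambda>k. u (int k))"
    using normal_form_frame[OF assms(1) _ nf v] unfolding assms(2) by auto
  interpret dihedral_frame n "-1" u w a b \<Phi> c by (rule fr)
  show "is_ETF (2 * n) n \<Phi> \<and> regular_configuration n \<pi> v \<longleftrightarrow>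
      (\<exists>P Q. negacirculant n P \<and> negacirculant n Q \<and> skew_hadamard (2 * n) (skew_block P Q) \<and>
        switching_equivalent (2 * n) (mat_adjoint \<Phi> * \<Phi>) (target_gram n P Q))"
  proof
    assume "is_ETF (2 * n) n \<Phi> \<and> regular_configuration n \<pi> v"
    then obtain P Q p q where PQ: "P \<in> carrier_mat n n" "Q \<in> carrier_mat n n"
      "\<forall>i<n. \<forall>j<n. P $$ (i, j) = p (int j - int i) \<and> Q $$ (i, j) = q (int j - int i)"
      "\<forall>k. - int n < k \<longrightarrow> k < 0 \<longrightarrow> p (k + int n) = Re (-1) * p k \<and> q (k + int n) = Re (-1) * q k"
      "skew_hadamard (2 * n) (skew_block P Q)"
      "switching_equivalent (2 * n) (mat_adjoint \<Phi> * \<Phi>) (target_gram n P Q)"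
      using skew_hadamard_of_ETF reg by blast
    \<comment> \<open>With \<open>z = -1\<close> the wrap-around factor is the sign change of a
      negacirculant matrix.\<close>
    moreover have "negacirculant n P" "negacirculant n Q"
      using PQ(1-4) by (auto intro: negacirculantI[of _ _ p] negacirculantI[of _ _ q])
    ultimately show "\<exists>P Q. negacirculant n P \<and> negacirculant n Q \<and>
        skew_hadamard (2 * n) (skew_block P Q) \<and>
        switching_equivalent (2 * n) (mat_adjoint \<Phi> * \<Phi>) (target_gram n P Q)" by blast
  next
    assume "\<exists>P Q. negacirculant n P \<and> negacirculant n Q \<and> skew_hadamard (2 * n) (skew_block P Q) \<and>
        switching_equivalent (2 * n) (mat_adjoint \<Phi> * \<Phi>) (target_gram n P Q)"
    then show "is_ETF (2 * n) n \<Phi> \<and> regular_configuration n \<pi> v"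
      using ETF_of_skew_hadamard reg unfolding negacirculant_def by blast
  qed
qed

end
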